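(* Let $\Bbbk$ be a field of characteristic $0$, let $H$ be a connected Hopf algebra over $\Bbbk$, let $A$ be an $H$-module algebra, and let $I$ be an ideal of $A$. Let $(I:H) = \{ a \in A \mid h.a \in I \text{ for all } h \in H \}$ be the $H$-core of $I$. If $I$ is prime (respectively semiprime, completely prime), then $(I:H)$ is prime (respectively semiprime, completely prime).
   Context: Algebras are associative with $1$, not necessarily commutative; ideals are two-sided. A Hopf algebra $H$ over $\Bbbk$, with comultiplication $\Delta(h) = h_1 \otimes h_2$ (Sweedler notation) and counit $\epsilon$, is connected if its coradical (the sum of all its simple subcoalgebras) is $\Bbbk = \Bbbk 1$, i.e. $H$ has no simple subcoalgebras other than $\Bbbk 1$. An $H$-module algebra is a $\Bbbk$-algebra $A$ equipped with a left $H$-module structure $H \otimes_\Bbbk A \to A$, $h \otimes a \mapsto h.a$, such that $h.(ab) = (h_1.a)(h_2.b)$ and $h.1 = \epsilon(h)1$ for all $h \in H$, $a,b \in A$. The $H$-core $(I:H)$ is the unique largest ideal of $A$ that is contained in $I$ and is also an $H$-submodule of $A$. An ideal $I$ of $A$ is prime, semiprime, or completely prime if the ring $A/I$ is prime, semiprime, or a (not necessarily commutative) domain, respectively. *)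

theory Defs
  imports
    Complex_Main
    "HOL-Library.Poly_Mapping"
    "HOL-Algebra.QuotRing"
    "HOL-Algebra.Ideal_Product"
begin

section \<open>Tensor powers of a vector space\<close>

text \<open>
  Over a field \<open>'k\<close>, finitely supported functions \<open>'x \<Rightarrow>\<^sub>0 'k\<close> form the free vector space on
  \<open>'x\<close>. The tensor product \<open>V \<otimes> V\<close> is the quotient of the free vector space on \<open>V \<times> V\<close>
  by the subspace spanned by the bilinearity relators. As this quotient depends on the scalar
  multiplication of \<open>V\<close>, it is not formed as a type: tensors are represented by elements of the
  free vector space and are compared modulo that subspace.
\<close>

definition free_scale :: "'k::field \<Rightarrow> ('x \<Rightarrow>\<^sub>0 'k) \<Rightarrow> ('x \<Rightarrow>\<^sub>0 'k)"
  where "free_scale c t = Poly_Mapping.map ((*) c) t"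

lemma lookup_free_scale [simp]:
  "Poly_Mapping.lookup (free_scale c t) x = c * Poly_Mapping.lookup t x"
  by (simp add: free_scale_def Poly_Mapping.map.rep_eq when_def)

global_interpretation free_vs: vector_space free_scale
  by unfold_locales
    (auto intro!: poly_mapping_eqI simp: lookup_add algebra_simps)

abbreviation basis_vec :: "'x \<Rightarrow> ('x \<Rightarrow>\<^sub>0 'k::field)"
  where "basis_vec x \<equiv> Poly_Mapping.single x 1"

text \<open>The linear extension of \<open>f\<close> from the basis \<open>'x\<close> to the free vector space on \<open>'x\<close>.\<close>

definition free_extend ::
    "('k::field \<Rightarrow> 'b::ab_group_add \<Rightarrow> 'b) \<Rightarrow> ('x \<Rightarrow> 'b) \<Rightarrow> ('x \<Rightarrow>\<^sub>0 'k) \<Rightarrow> 'b"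
  where "free_extend scale f t =
    (\<Sum>x\<in>Poly_Mapping.keys t. scale (Poly_Mapping.lookup t x) (f x))"

inductive_set tensor2_relators ::
    "('k::field \<Rightarrow> 'v::ab_group_add \<Rightarrow> 'v) \<Rightarrow> ('v \<times> 'v \<Rightarrow>\<^sub>0 'k) set"
  for scale :: "'k \<Rightarrow> 'v \<Rightarrow> 'v"
  where
    "basis_vec (x + x', y) - (basis_vec (x, y) + basis_vec (x', y)) \<in> tensor2_relators scale"
  | "basis_vec (x, y + y') - (basis_vec (x, y) + basis_vec (x, y')) \<in> tensor2_relators scale"
  | "basis_vec (scale c x, y) - free_scale c (basis_vec (x, y)) \<in> tensor2_relators scale"
  | "basis_vec (x, scale c y) - free_scale c (basis_vec (x, y)) \<in> tensor2_relators scale"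

inductive_set tensor3_relators ::
    "('k::field \<Rightarrow> 'v::ab_group_add \<Rightarrow> 'v) \<Rightarrow> ('v \<times> 'v \<times> 'v \<Rightarrow>\<^sub>0 'k) set"
  for scale :: "'k \<Rightarrow> 'v \<Rightarrow> 'v"
  where
    "basis_vec (x + x', y, z) - (basis_vec (x, y, z) + basis_vec (x', y, z))
      \<in> tensor3_relators scale"
  | "basis_vec (x, y + y', z) - (basis_vec (x, y, z) + basis_vec (x, y', z))
      \<in> tensor3_relators scale"
  | "basis_vec (x, y, z + z') - (basis_vec (x, y, z) + basis_vec (x, y, z'))
      \<in> tensor3_relators scale"
  | "basis_vec (scale c x, y, z) - free_scale c (basis_vec (x, y, z)) \<in> tensor3_relators scale"
  | "basis_vec (x, scale c y, z) - free_scale c (basis_vec (x, y, z)) \<in> tensor3_relators scale"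
  | "basis_vec (x, y, scale c z) - free_scale c (basis_vec (x, y, z)) \<in> tensor3_relators scale"

definition tensor2_eq ::
    "('k::field \<Rightarrow> 'v::ab_group_add \<Rightarrow> 'v) \<Rightarrow> ('v \<times> 'v \<Rightarrow>\<^sub>0 'k) \<Rightarrow> ('v \<times> 'v \<Rightarrow>\<^sub>0 'k) \<Rightarrow> bool"
  where "tensor2_eq scale s t \<longleftrightarrow> s - t \<in> free_vs.span (tensor2_relators scale)"

definition tensor3_eq ::
    "('k::field \<Rightarrow> 'v::ab_group_add \<Rightarrow> 'v) \<Rightarrow> ('v \<times> 'v \<times> 'v \<Rightarrow>\<^sub>0 'k) \<Rightarrow> ('v \<times> 'v \<times> 'v \<Rightarrow>\<^sub>0 'k) \<Rightarrow> bool"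
  where "tensor3_eq scale s t \<longleftrightarrow> s - t \<in> free_vs.span (tensor3_relators scale)"

text \<open>The product of \<open>H \<otimes> H\<close>, determined by \<open>(a \<otimes> b) (c \<otimes> d) = ac \<otimes> bd\<close>.\<close>

definition tensor2_mult ::
    "('h::times \<times> 'h \<Rightarrow>\<^sub>0 'k::field) \<Rightarrow> ('h \<times> 'h \<Rightarrow>\<^sub>0 'k) \<Rightarrow> ('h \<times> 'h \<Rightarrow>\<^sub>0 'k)"
  where "tensor2_mult s t =
    free_extend free_scale (\<lambda>(a, b).
      free_extend free_scale (\<lambda>(c, d). basis_vec (a * c, b * d)) t) s"


section \<open>Algebras, coalgebras and Hopf algebras\<close>

text \<open>
  The sort \<open>{ring, monoid_mult}\<close> describes associative rings with \<open>1\<close>, not necessarily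
  commutative. In contrast to \<open>ring_1\<close> it does not exclude the zero ring.
\<close>

locale k_algebra = vector_space scale
  for scale :: "'k::field \<Rightarrow> 'a::{ring, monoid_mult} \<Rightarrow> 'a" +
  assumes scale_mult_left: "scale c x * y = scale c (x * y)"
    and scale_mult_right: "x * scale c y = scale c (x * y)"

text \<open>
  \<open>\<Delta> x\<close> is a representative of the comultiplication of \<open>x\<close>; hence \<open>\<Delta>\<close> itself is linear,
  coassociative (and multiplicative, in a bialgebra) only modulo the tensor relations.
\<close>

locale coalgebra = vector_space scale
  for scale :: "'k::field \<Rightarrow> 'c::ab_group_add \<Rightarrow> 'c" +
  fixes \<Delta> :: "'c \<Rightarrow> ('c \<times> 'c \<Rightarrow>\<^sub>0 'k)"
    and \<epsilon> :: "'c \<Rightarrow> 'k"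
  assumes comult_add: "tensor2_eq scale (\<Delta> (x + y)) (\<Delta> x + \<Delta> y)"
    and comult_scale: "tensor2_eq scale (\<Delta> (scale c x)) (free_scale c (\<Delta> x))"
    and counit_linear: "Vector_Spaces.linear scale (*) \<epsilon>"
    and coassoc: "tensor3_eq scale
      (free_extend free_scale (\<lambda>(a, b).
         free_extend free_scale (\<lambda>(a1, a2). basis_vec (a1, a2, b)) (\<Delta> a)) (\<Delta> x))
      (free_extend free_scale (\<lambda>(a, b).
         free_extend free_scale (\<lambda>(b1, b2). basis_vec (a, b1, b2)) (\<Delta> b)) (\<Delta> x))"
    and counit_left: "free_extend scale (\<lambda>(a, b). scale (\<epsilon> a) b) (\<Delta> x) = x"
    and counit_right: "free_extend scale (\<lambda>(a, b). scale (\<epsilon> b) a) (\<Delta> x) = x"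
begin

text \<open>A subspace \<open>C\<close> such that \<open>\<Delta> C\<close> lies in the image of \<open>C \<otimes> C\<close> in the whole tensor square.\<close>

definition subcoalgebra :: "'c set \<Rightarrow> bool"
  where "subcoalgebra C \<longleftrightarrow> subspace C \<and>
    (\<forall>x\<in>C. \<exists>t. Poly_Mapping.keys t \<subseteq> C \<times> C \<and> tensor2_eq scale (\<Delta> x) t)"

definition simple_subcoalgebra :: "'c set \<Rightarrow> bool"
  where "simple_subcoalgebra C \<longleftrightarrow> subcoalgebra C \<and> C \<noteq> {0} \<and>
    (\<forall>D. subcoalgebra D \<and> D \<subseteq> C \<longrightarrow> D = {0} \<or> D = C)"

definition coradical :: "'c set"
  where "coradical = span (\<Union>{C. simple_subcoalgebra C})"

end

locale bialgebra = k_algebra scale + coalgebra scale \<Delta> \<epsilon>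
  for scale :: "'k::field \<Rightarrow> 'h::{ring, monoid_mult} \<Rightarrow> 'h"
    and \<Delta> :: "'h \<Rightarrow> ('h \<times> 'h \<Rightarrow>\<^sub>0 'k)"
    and \<epsilon> :: "'h \<Rightarrow> 'k" +
  assumes comult_mult: "tensor2_eq scale (\<Delta> (x * y)) (tensor2_mult (\<Delta> x) (\<Delta> y))"
    and comult_one: "tensor2_eq scale (\<Delta> 1) (basis_vec (1, 1))"
    and counit_mult: "\<epsilon> (x * y) = \<epsilon> x * \<epsilon> y"
    and counit_one: "\<epsilon> 1 = 1"

locale hopf_algebra = bialgebra scale \<Delta> \<epsilon>
  for scale :: "'k::field \<Rightarrow> 'h::{ring, monoid_mult} \<Rightarrow> 'h"
    and \<Delta> :: "'h \<Rightarrow> ('h \<times> 'h \<Rightarrow>\<^sub>0 'k)"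
    and \<epsilon> :: "'h \<Rightarrow> 'k" +
  fixes S :: "'h \<Rightarrow> 'h"
  assumes antipode_linear: "Vector_Spaces.linear scale scale S"
    and antipode_left: "free_extend scale (\<lambda>(a, b). S a * b) (\<Delta> x) = scale (\<epsilon> x) 1"
    and antipode_right: "free_extend scale (\<lambda>(a, b). a * S b) (\<Delta> x) = scale (\<epsilon> x) 1"

locale connected_hopf_algebra = hopf_algebra scale \<Delta> \<epsilon> S
  for scale :: "'k::field \<Rightarrow> 'h::{ring, monoid_mult} \<Rightarrow> 'h"
    and \<Delta> :: "'h \<Rightarrow> ('h \<times> 'h \<Rightarrow>\<^sub>0 'k)"
    and \<epsilon> :: "'h \<Rightarrow> 'k"
    and S :: "'h \<Rightarrow> 'h" +
  assumes connected: "coradical = range (\<lambda>c. scale c 1)"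


section \<open>Prime, semiprime and completely prime ideals\<close>

definition ring_of_type :: "'a::{ring, monoid_mult} ring"
  where "ring_of_type =
    \<lparr>carrier = UNIV, monoid.mult = (*), one = 1, ring.zero = 0, add = (+)\<rparr>"

lemma ring_ring_of_type: "ring (ring_of_type :: 'a::{ring, monoid_mult} ring)"
proof -
  have "\<exists>y. x + y = 0" for x :: 'a
    using add.right_inverse by blast
  then show ?thesis
    unfolding ring_of_type_def using add.right_inverse
    by unfold_locales (auto simp: algebra_simps Units_def)
qed

definition prime_ring :: "('a, 'b) ring_scheme \<Rightarrow> bool"
  where "prime_ring R \<longleftrightarrow> ring R \<and> \<one>\<^bsub>R\<^esub> \<noteq> \<zero>\<^bsub>R\<^esub> \<and>
    (\<forall>J K. ideal J R \<and> ideal K R \<and> ideal_prod R J K = {\<zero>\<^bsub>R\<^esub>} \<longrightarrow>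
      J = {\<zero>\<^bsub>R\<^esub>} \<or> K = {\<zero>\<^bsub>R\<^esub>})"

definition semiprime_ring :: "('a, 'b) ring_scheme \<Rightarrow> bool"
  where "semiprime_ring R \<longleftrightarrow> ring R \<and>
    (\<forall>J. ideal J R \<and> ideal_prod R J J = {\<zero>\<^bsub>R\<^esub>} \<longrightarrow> J = {\<zero>\<^bsub>R\<^esub>})"

text \<open>The locale \<open>domain\<close> of the library is restricted to commutative rings.\<close>

definition noncomm_domain :: "('a, 'b) ring_scheme \<Rightarrow> bool"
  where "noncomm_domain R \<longleftrightarrow> ring R \<and> \<one>\<^bsub>R\<^esub> \<noteq> \<zero>\<^bsub>R\<^esub> \<and>
    (\<forall>a\<in>carrier R. \<forall>b\<in>carrier R. a \<otimes>\<^bsub>R\<^esub> b = \<zero>\<^bsub>R\<^esub> \<longrightarrow> a = \<zero>\<^bsub>R\<^esub> \<or> b = \<zero>\<^bsub>R\<^esub>)"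

definition prime_ideal :: "'a::{ring, monoid_mult} set \<Rightarrow> bool"
  where "prime_ideal I \<longleftrightarrow> ideal I ring_of_type \<and> prime_ring (ring_of_type Quot I)"

definition semiprime_ideal :: "'a::{ring, monoid_mult} set \<Rightarrow> bool"
  where "semiprime_ideal I \<longleftrightarrow> ideal I ring_of_type \<and> semiprime_ring (ring_of_type Quot I)"

definition completely_prime_ideal :: "'a::{ring, monoid_mult} set \<Rightarrow> bool"
  where "completely_prime_ideal I \<longleftrightarrow>
    ideal I ring_of_type \<and> noncomm_domain (ring_of_type Quot I)"


section \<open>Module algebras\<close>

locale module_algebra =
  H: hopf_algebra scaleH \<Delta> \<epsilon> S + A: k_algebra scaleA
  for scaleH :: "'k::field \<Rightarrow> 'h::{ring, monoid_mult} \<Rightarrow> 'h"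
    and \<Delta> :: "'h \<Rightarrow> ('h \<times> 'h \<Rightarrow>\<^sub>0 'k)"
    and \<epsilon> :: "'h \<Rightarrow> 'k"
    and S :: "'h \<Rightarrow> 'h"
    and scaleA :: "'k \<Rightarrow> 'a::{ring, monoid_mult} \<Rightarrow> 'a" +
  fixes act :: "'h \<Rightarrow> 'a \<Rightarrow> 'a"
  assumes act_linear_left: "Vector_Spaces.linear scaleH scaleA (\<lambda>h. act h a)"
    and act_linear_right: "Vector_Spaces.linear scaleA scaleA (act h)"
    and act_one_left: "act 1 a = a"
    and act_mult_left: "act (g * h) a = act g (act h a)"
    and act_mult: "act h (a * b) = free_extend scaleA (\<lambda>(h1, h2). act h1 a * act h2 b) (\<Delta> h)"
    and act_one: "act h 1 = scaleA (\<epsilon> h) 1"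
begin

definition core :: "'a set \<Rightarrow> 'a set"
  where "core I = {a. \<forall>h. act h a \<in> I}"

text \<open>The core is the largest ideal that is contained in \<open>I\<close> and stable under the action.\<close>

lemma core_largest:
  assumes I: "ideal I ring_of_type"
  shows "ideal (core I) ring_of_type"
    and "core I \<subseteq> I"
    and "a \<in> core I \<Longrightarrow> act h a \<in> core I"
    and "ideal J ring_of_type \<Longrightarrow> J \<subseteq> I \<Longrightarrow> (\<And>h a. a \<in> J \<Longrightarrow> act h a \<in> J) \<Longrightarrow> J \<subseteq> core I"
proof -
  interpret I: ideal I "ring_of_type :: 'a ring" by (rule I)
  have grp: "Group.group (add_monoid (ring_of_type :: 'a ring))"
    using abelian_group.a_group ring.is_abelian_group ring_ring_of_type by blast
  have add_mem: "x + y \<in> I" if "x \<in> I" "y \<in> I" for x y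
    using additive_subgroup.a_closed[OF I.additive_subgroup_axioms that] by (simp add: ring_of_type_def)
  have zero_mem: "0 \<in> I"
    using additive_subgroup.zero_closed[OF I.additive_subgroup_axioms] by (simp add: ring_of_type_def)
  have mult_l: "x * y \<in> I" if "y \<in> I" for x y
    using I.I_l_closed[OF that, of x] by (simp add: ring_of_type_def)
  have mult_r: "y * x \<in> I" if "y \<in> I" for x y
    using I.I_r_closed[OF that, of x] by (simp add: ring_of_type_def)
  have scale_mem: "scaleA c x \<in> I" if "x \<in> I" for c x
    using mult_l[OF that, of "scaleA c 1"] by (simp add: A.scale_mult_left)
  have uminus_mem: "- x \<in> I" if "x \<in> I" for x
    using scale_mem[OF that, of "- 1"] by simp
  have ext_mem: "free_extend scaleA f t \<in> I" if "\<And>x. f x \<in> I" for f :: "'h \<times> 'h \<Rightarrow> 'a" and t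
  proof -
    have "(\<Sum>x\<in>X. scaleA (c x) (f x)) \<in> I" if "finite X" for X c
      using that by induction (simp_all add: zero_mem add_mem scale_mem \<open>\<And>x. f x \<in> I\<close>)
    then show ?thesis
      by (simp add: free_extend_def)
  qed
  have act_add: "act h (x + y) = act h x + act h y" for h x y
    by (rule Vector_Spaces.linear.axioms(3)[OF act_linear_right, THEN module_hom.add])
  have act_zero: "act h 0 = 0" for h
    using act_add[of h 0 0] by simp
  have act_uminus: "act h (- x) = - act h x" for h x
    using act_add[of h x "- x"] by (simp add: act_zero eq_neg_iff_add_eq_0 add.commute)
  show "ideal (core I) ring_of_type"
  proof (rule idealI)
    show "ring (ring_of_type :: 'a ring)" by (rule ring_ring_of_type)
    show "subgroup (core I) (add_monoid ring_of_type)"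
    proof (rule group.subgroupI[OF grp])
      show "core I \<subseteq> carrier (add_monoid ring_of_type)"
        by (simp add: ring_of_type_def)
      have "0 \<in> core I"
        by (simp add: core_def act_zero zero_mem)
      then show "core I \<noteq> {}"
        by blast
      show "inv\<^bsub>add_monoid ring_of_type\<^esub> x \<in> core I" if "x \<in> core I" for x
      proof -
        have "inv\<^bsub>add_monoid ring_of_type\<^esub> x = - x"
          by (rule group.inv_equality[OF grp]) (auto simp: ring_of_type_def)
        then show ?thesis
          using that by (simp add: core_def act_uminus uminus_mem)
      qed
      show "x \<otimes>\<^bsub>add_monoid ring_of_type\<^esub> y \<in> core I" if "x \<in> core I" "y \<in> core I" for x y
        using that by (simp add: core_def ring_of_type_def act_add add_mem)
    qed
    show "x \<otimes>\<^bsub>ring_of_type\<^esub> a \<in> core I" if "a \<in> core I" for a x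
      using that by (auto simp: core_def ring_of_type_def act_mult intro!: ext_mem mult_l)
    show "a \<otimes>\<^bsub>ring_of_type\<^esub> x \<in> core I" if "a \<in> core I" for a x
      using that by (auto simp: core_def ring_of_type_def act_mult intro!: ext_mem mult_r)
  qed
  show "core I \<subseteq> I"
    unfolding core_def using act_one_left by (metis (mono_tags, lifting) mem_Collect_eq subsetI)
  show "act h a \<in> core I" if "a \<in> core I"
    using that by (simp add: core_def act_mult_left[symmetric])
  show "J \<subseteq> core I" if "J \<subseteq> I" "\<And>h a. a \<in> J \<Longrightarrow> act h a \<in> J"
    using that by (auto simp: core_def)
qed

end

end

theory Submission
  imports Defs "HOL-Library.Multiset_Order"
begin

text \<open>
  Let \<open>H\<^sub>n\<close> be the coradical filtration of \<open>H\<close>. Connectedness makes it exhaustive, and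
  \<open>h \<in> H\<^sub>n\<close> with \<open>\<epsilon> h = 0\<close> satisfies \<open>\<Delta> h \<in> h \<otimes> 1 + 1 \<otimes> h + \<Sum> H\<^sub>p \<otimes> H\<^sub>q\<close> with \<open>p, q \<ge> 1\<close> and \<open>p + q \<le> n\<close>. Hence
  \<open>H\<^sub>i H\<^sub>j \<subseteq> H\<^sub>i\<^sub>+\<^sub>j\<close> and \<open>[H\<^sub>i, H\<^sub>j] \<subseteq> H\<^sub>i\<^sub>+\<^sub>j\<^sub>-\<^sub>1\<close>, that is, the associated graded algebra is commutative.

  For \<open>a\<close> outside the core let \<open>n\<close> be minimal with \<open>H\<^sub>n.a\<close> not contained in \<open>I\<close>, and \<open>j\<close> the maximal
  number of factors of positive degree in a product \<open>x\<^sub>1 \<cdots> x\<^sub>j\<close> of degree \<open>n\<close> with \<open>(x\<^sub>1 \<cdots> x\<^sub>j).a \<notin> I\<close>; let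
  \<open>m\<close> and \<open>l\<close> be the corresponding numbers for \<open>b\<close>. Modulo \<open>I\<close>, a product of \<open>j + l\<close> factors of
  degree \<open>n + m\<close> acts on \<open>a b\<close> as if all factors were commuting derivations. As in a polynomial ring,
  the leading monomials \<open>x\<close> of \<open>a\<close> and \<open>y\<close> of \<open>b\<close> for a monomial order then give
  \<open>(x y).(a b) \<equiv> N (x.a) (y.b)\<close> with a positive integer \<open>N\<close>, which is invertible in
  characteristic \<open>0\<close>. Replacing \<open>a\<close> by \<open>a c\<close> multiplies \<open>x.a\<close> by \<open>c\<close>, so each kind of primeness of \<open>I\<close>
  passes to the core.
\<close>

section \<open>Linear extension and Sweedler sums\<close>

context vector_space
begin

lemma free_extend_superset:
  assumes "finite X" "Poly_Mapping.keys t \<subseteq> X"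
  shows "free_extend scale f t = (\<Sum>x\<in>X. scale (Poly_Mapping.lookup t x) (f x))"
  unfolding free_extend_def using assms
  by (intro sum.mono_neutral_left) (auto simp: in_keys_iff)

lemma free_extend_basis_vec [simp]: "free_extend scale f (basis_vec x) = f x"
  using free_extend_superset[of "{x}" "basis_vec x" f] by simp

lemma free_extend_add: "free_extend scale f (s + t) = free_extend scale f s + free_extend scale f t"
proof -
  let ?X = "Poly_Mapping.keys s \<union> Poly_Mapping.keys t"
  have "Poly_Mapping.keys (s + t) \<subseteq> ?X"
    by (rule Poly_Mapping.keys_add)
  then show ?thesis
    by (simp add: free_extend_superset[of ?X] lookup_add scale_left_distrib sum.distrib)
qed

lemma free_extend_free_scale: "free_extend scale f (free_scale c t) = scale c (free_extend scale f t)"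
proof -
  have "Poly_Mapping.keys (free_scale c t) \<subseteq> Poly_Mapping.keys t"
    by (auto simp: in_keys_iff)
  then show ?thesis
    by (simp add: free_extend_superset[of "Poly_Mapping.keys t"] scale_sum_right)
qed

lemma linear_free_extend: "Vector_Spaces.linear free_scale scale (free_extend scale f)"
  unfolding Vector_Spaces.linear_iff
  using free_extend_add free_extend_free_scale free_vs.vector_space_axioms vector_space_axioms by blast

lemma free_extend_diff: "free_extend scale f (s - t) = free_extend scale f s - free_extend scale f t"
  using free_extend_add[of f "s - t" t] by simp

text \<open>The universal property of a quotient of a free space: a linear extension that kills the
  relators cannot distinguish two representatives of one tensor.\<close>

lemma free_extend_eq_if_relators_vanish:
  assumes "s - t \<in> free_vs.span T" "\<And>r. r \<in> T \<Longrightarrow> free_extend scale f r = 0"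
  shows "free_extend scale f s = free_extend scale f t"
proof -
  interpret l: Vector_Spaces.linear free_scale scale "free_extend scale f"
    by (rule linear_free_extend)
  have "free_extend scale f (s - t) = 0"
    using assms(1) by (rule l.eq_0_on_span[rotated]) (rule assms(2))
  then show ?thesis
    by (simp add: free_extend_diff)
qed

end

lemma linear_image_free_extend:
  assumes "Vector_Spaces.linear s1 s2 \<phi>"
  shows "\<phi> (free_extend s1 f t) = free_extend s2 (\<lambda>x. \<phi> (f x)) t"
proof -
  interpret Vector_Spaces.linear s1 s2 \<phi> by fact
  show ?thesis
    by (simp add: free_extend_def sum scale)
qed

lemma free_extend_free_extend:
  assumes "vector_space s"
  shows "free_extend s f (free_extend free_scale g t) = free_extend s (\<lambda>x. free_extend s f (g x)) t"
  by (rule linear_image_free_extend[OF vector_space.linear_free_extend[OF assms]])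

lemma vector_space_mult: "vector_space ((*) :: 'k::field \<Rightarrow> 'k \<Rightarrow> 'k)"
  by unfold_locales (auto simp: algebra_simps)

lemma linear_map_add: "Vector_Spaces.linear s1 s2 f \<Longrightarrow> f (x + y) = f x + f y"
  and linear_map_scale: "Vector_Spaces.linear s1 s2 f \<Longrightarrow> f (s1 c x) = s2 c (f x)"
  by (simp_all add: Vector_Spaces.linear_iff)

lemma linear_map_0: "Vector_Spaces.linear s1 s2 f \<Longrightarrow> f 0 = 0"
  using linear_map_add[of s1 s2 f 0 0] by simp

lemma linear_map_diff: "Vector_Spaces.linear s1 s2 f \<Longrightarrow> f (x - y) = f x - f y"
  using linear_map_add[of s1 s2 f "x - y" y] by simp

lemma linear_map_sum: "Vector_Spaces.linear s1 s2 f \<Longrightarrow> f (sum g X) = (\<Sum>x\<in>X. f (g x))"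
  by (induction X rule: infinite_finite_induct) (simp_all add: linear_map_0 linear_map_add)

lemma linear_map_comp:
  "Vector_Spaces.linear s2 s3 g \<Longrightarrow> Vector_Spaces.linear s1 s2 f \<Longrightarrow>
    Vector_Spaces.linear s1 s3 (\<lambda>x. g (f x))"
  by (simp add: Vector_Spaces.linear_iff)

context coalgebra
begin

definition bilin :: "('k \<Rightarrow> 'w::ab_group_add \<Rightarrow> 'w) \<Rightarrow> ('c \<Rightarrow> 'c \<Rightarrow> 'w) \<Rightarrow> bool"
  where "bilin s \<beta> \<longleftrightarrow>
    (\<forall>y. Vector_Spaces.linear scale s (\<lambda>x. \<beta> x y)) \<and> (\<forall>x. Vector_Spaces.linear scale s (\<beta> x))"

definition trilin :: "('k \<Rightarrow> 'w::ab_group_add \<Rightarrow> 'w) \<Rightarrow> ('c \<Rightarrow> 'c \<Rightarrow> 'c \<Rightarrow> 'w) \<Rightarrow> bool"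
  where "trilin s \<tau> \<longleftrightarrow> (\<forall>y z. Vector_Spaces.linear scale s (\<lambda>x. \<tau> x y z)) \<and>
    (\<forall>x. bilin s (\<tau> x))"

text \<open>The sum written \<beta>(x_1, x_2) in Sweedler notation. For bilinear \<beta> it does not
  depend on the representative \<open>\<Delta> x\<close>.\<close>

definition sweedler :: "('k \<Rightarrow> 'w::ab_group_add \<Rightarrow> 'w) \<Rightarrow> ('c \<Rightarrow> 'c \<Rightarrow> 'w) \<Rightarrow> 'c \<Rightarrow> 'w"
  where "sweedler s \<beta> x = free_extend s (\<lambda>(a, b). \<beta> a b) (\<Delta> x)"

abbreviation functional :: "('c \<Rightarrow> 'k) \<Rightarrow> bool"
  where "functional \<equiv> Vector_Spaces.linear scale (*)"

lemma functional_iff: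
  "functional f \<longleftrightarrow> (\<forall>x y. f (x + y) = f x + f y) \<and> (\<forall>c x. f (scale c x) = c * f x)"
  by (simp add: Vector_Spaces.linear_iff vector_space_mult vector_space_axioms)

lemma linear_endo_iff:
  "Vector_Spaces.linear scale scale f \<longleftrightarrow>
    (\<forall>x y. f (x + y) = f x + f y) \<and> (\<forall>c x. f (scale c x) = scale c (f x))"
  by (simp add: Vector_Spaces.linear_iff vector_space_axioms)

lemma bilin_iff:
  "bilin s \<beta> \<longleftrightarrow> vector_space s \<and>
    (\<forall>x x' y. \<beta> (x + x') y = \<beta> x y + \<beta> x' y) \<and> (\<forall>c x y. \<beta> (scale c x) y = s c (\<beta> x y)) \<and>
    (\<forall>x y y'. \<beta> x (y + y') = \<beta> x y + \<beta> x y') \<and> (\<forall>c x y. \<beta> x (scale c y) = s c (\<beta> x y))"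
  unfolding bilin_def Vector_Spaces.linear_iff using vector_space_axioms by auto

lemma trilin_iff:
  "trilin s \<tau> \<longleftrightarrow> vector_space s \<and>
    (\<forall>x x' y z. \<tau> (x + x') y z = \<tau> x y z + \<tau> x' y z) \<and> (\<forall>c x y z. \<tau> (scale c x) y z = s c (\<tau> x y z)) \<and>
    (\<forall>x y y' z. \<tau> x (y + y') z = \<tau> x y z + \<tau> x y' z) \<and> (\<forall>c x y z. \<tau> x (scale c y) z = s c (\<tau> x y z)) \<and>
    (\<forall>x y z z'. \<tau> x y (z + z') = \<tau> x y z + \<tau> x y z') \<and> (\<forall>c x y z. \<tau> x y (scale c z) = s c (\<tau> x y z))"
  unfolding trilin_def bilin_iff Vector_Spaces.linear_iff using vector_space_axioms by auto

lemma bilin_target: "bilin s \<beta> \<Longrightarrow> vector_space s"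
  by (simp add: bilin_iff)

lemma free_extend_tensor2_eq:
  assumes "tensor2_eq scale t u" "bilin s \<beta>"
  shows "free_extend s (\<lambda>(a, b). \<beta> a b) t = free_extend s (\<lambda>(a, b). \<beta> a b) u"
proof -
  interpret s: vector_space s using assms(2) by (rule bilin_target)
  show ?thesis
  proof (rule s.free_extend_eq_if_relators_vanish)
    show "t - u \<in> free_vs.span (tensor2_relators scale)"
      using assms(1) by (simp add: tensor2_eq_def)
    show "free_extend s (\<lambda>(a, b). \<beta> a b) r = 0" if "r \<in> tensor2_relators scale" for r
      using that assms(2)
      by induction (simp_all add: bilin_iff s.free_extend_diff s.free_extend_add s.free_extend_free_scale)
  qed
qed

lemma free_extend_tensor3_eq:
  assumes "tensor3_eq scale t u" "trilin s \<tau>"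
  shows "free_extend s (\<lambda>(a, b, c). \<tau> a b c) t = free_extend s (\<lambda>(a, b, c). \<tau> a b c) u"
proof -
  interpret s: vector_space s using assms(2) by (simp add: trilin_iff)
  show ?thesis
  proof (rule s.free_extend_eq_if_relators_vanish)
    show "t - u \<in> free_vs.span (tensor3_relators scale)"
      using assms(1) by (simp add: tensor3_eq_def)
    show "free_extend s (\<lambda>(a, b, c). \<tau> a b c) r = 0" if "r \<in> tensor3_relators scale" for r
      using that assms(2)
      by induction (simp_all add: trilin_iff s.free_extend_diff s.free_extend_add s.free_extend_free_scale)
  qed
qed

text \<open>\<open>\<Delta>\<close> itself is linear only modulo the relators; bilinearity of
  \<beta> absorbs the difference.\<close>

lemma linear_sweedler:
  assumes "bilin s \<beta>"
  shows "Vector_Spaces.linear scale s (sweedler s \<beta>)"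
proof -
  interpret s: vector_space s using assms by (rule bilin_target)
  show ?thesis
    unfolding Vector_Spaces.linear_iff sweedler_def
    using free_extend_tensor2_eq[OF comult_add assms] free_extend_tensor2_eq[OF comult_scale assms]
      vector_space_axioms s.vector_space_axioms
    by (simp add: s.free_extend_add s.free_extend_free_scale)
qed

lemma linear_image_sweedler:
  assumes "Vector_Spaces.linear s1 s2 \<phi>"
  shows "\<phi> (sweedler s1 \<beta> x) = sweedler s2 (\<lambda>a b. \<phi> (\<beta> a b)) x"
  unfolding sweedler_def linear_image_free_extend[OF assms] by (simp add: case_prod_unfold)

text \<open>Applying a trilinear map to the coassociativity relation in the tensor cube turns it
  into an exchange of nested sums, the only form in which it is used below.\<close>

lemma sweedler_coassoc:
  assumes "trilin s \<tau>"
  shows "sweedler s (\<lambda>a c. sweedler s (\<lambda>a b. \<tau> a b c) a) x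
    = sweedler s (\<lambda>a b. sweedler s (\<lambda>b c. \<tau> a b c) b) x"
proof -
  interpret s: vector_space s using assms by (simp add: trilin_iff)
  show ?thesis
    using free_extend_tensor3_eq[OF coassoc[of x] assms]
    unfolding sweedler_def free_extend_free_extend[OF s.vector_space_axioms]
    by (simp add: case_prod_unfold free_extend_free_extend[OF s.vector_space_axioms])
qed

lemma sweedler_counit_left:
  assumes "Vector_Spaces.linear scale s g"
  shows "sweedler s (\<lambda>a b. s (\<epsilon> a) (g b)) x = g x"
  using linear_image_sweedler[OF assms, of "\<lambda>a b. scale (\<epsilon> a) b" x] counit_left[of x]
  by (simp add: sweedler_def linear_map_scale[OF assms])

lemma sweedler_counit_right:
  assumes "Vector_Spaces.linear scale s g"
  shows "sweedler s (\<lambda>a b. s (\<epsilon> b) (g a)) x = g x"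
  using linear_image_sweedler[OF assms, of "\<lambda>a b. scale (\<epsilon> b) a" x] counit_right[of x]
  by (simp add: sweedler_def linear_map_scale[OF assms])

lemma functional_counit: "functional \<epsilon>"
  by (rule counit_linear)

lemma sweedler_add:
  assumes "vector_space s"
  shows "sweedler s (\<lambda>a b. \<beta> a b + \<gamma> a b) x = sweedler s \<beta> x + sweedler s \<gamma> x"
  using assms
  by (simp add: sweedler_def free_extend_def case_prod_unfold sum.distrib vector_space.vector_space_assms)

lemma sweedler_diff:
  assumes "vector_space s"
  shows "sweedler s (\<lambda>a b. \<beta> a b - \<gamma> a b) x = sweedler s \<beta> x - sweedler s \<gamma> x"
  using sweedler_add[OF assms, of "\<lambda>a b. \<beta> a b - \<gamma> a b" \<gamma> x] by simp

lemma sweedler_sum: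
  assumes "vector_space s"
  shows "sweedler s (\<lambda>a b. \<Sum>i\<in>X. \<beta> i a b) x = (\<Sum>i\<in>X. sweedler s (\<beta> i) x)"
proof -
  interpret s: vector_space s by fact
  show ?thesis
    unfolding sweedler_def free_extend_def case_prod_unfold s.scale_sum_right by (rule sum.swap)
qed

lemma sweedler_scale:
  assumes "vector_space s"
  shows "sweedler s (\<lambda>a b. s c (\<beta> a b)) x = s c (sweedler s \<beta> x)"
proof -
  interpret s: vector_space s by fact
  show ?thesis
    unfolding sweedler_def free_extend_def case_prod_unfold s.scale_sum_right
    by (simp add: mult.commute)
qed

lemma sweedler_scale_left:
  assumes "vector_space s"
  shows "sweedler s (\<lambda>a b. s (\<beta> a b) w) x = s (sweedler (*) \<beta> x) w"
proof -
  interpret s: vector_space s by fact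
  show ?thesis
    unfolding sweedler_def free_extend_def case_prod_unfold s.scale_sum_left by simp
qed

lemma sweedler_cong:
  assumes "\<And>a b. (a, b) \<in> Poly_Mapping.keys (\<Delta> x) \<Longrightarrow> \<beta> a b = \<gamma> a b"
  shows "sweedler s \<beta> x = sweedler s \<gamma> x"
  unfolding sweedler_def free_extend_def using assms by (intro sum.cong) auto

lemma sweedler_swap:
  assumes "vector_space s"
  shows "sweedler s (\<lambda>a b. sweedler s (\<lambda>c d. \<gamma> a b c d) y) x
    = sweedler s (\<lambda>c d. sweedler s (\<lambda>a b. \<gamma> a b c d) x) y"
proof -
  interpret s: vector_space s by fact
  show ?thesis
    unfolding sweedler_def free_extend_def case_prod_unfold s.scale_sum_right
    by (subst sum.swap) (simp add: mult.commute)
qed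

subsection \<open>Translation by functionals\<close>

text \<open>The left action x -> x_1 f(x_2) of the dual algebra on the coalgebra. With the right
  action \<open>ltrans\<close> and the convolution product \<open>conv\<close>, coideals and
  filtrations can be described by vectors instead of tensors.\<close>

definition rtrans :: "('c \<Rightarrow> 'k) \<Rightarrow> 'c \<Rightarrow> 'c"
  where "rtrans f = sweedler scale (\<lambda>a b. scale (f b) a)"

definition ltrans :: "('c \<Rightarrow> 'k) \<Rightarrow> 'c \<Rightarrow> 'c"
  where "ltrans f = sweedler scale (\<lambda>a b. scale (f a) b)"

definition conv :: "('c \<Rightarrow> 'k) \<Rightarrow> ('c \<Rightarrow> 'k) \<Rightarrow> 'c \<Rightarrow> 'k"
  where "conv f g = sweedler (*) (\<lambda>a b. f a * g b)"

lemma linear_rtrans: "functional f \<Longrightarrow> Vector_Spaces.linear scale scale (rtrans f)"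
  unfolding rtrans_def
  by (rule linear_sweedler) (simp add: bilin_iff functional_iff vector_space_axioms algebra_simps)

lemma linear_ltrans: "functional f \<Longrightarrow> Vector_Spaces.linear scale scale (ltrans f)"
  unfolding ltrans_def
  by (rule linear_sweedler) (simp add: bilin_iff functional_iff vector_space_axioms algebra_simps)

lemma functional_conv: "functional f \<Longrightarrow> functional g \<Longrightarrow> functional (conv f g)"
  unfolding conv_def
  by (rule linear_sweedler) (simp add: bilin_iff functional_iff vector_space_mult algebra_simps)

lemma functional_rtrans: "functional f \<Longrightarrow> f (rtrans g x) = conv f g x"
  unfolding rtrans_def conv_def by (simp add: linear_image_sweedler linear_map_scale mult.commute)

lemma functional_ltrans: "functional g \<Longrightarrow> g (ltrans f x) = conv f g x"
  unfolding ltrans_def conv_def by (simp add: linear_image_sweedler linear_map_scale)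

lemma rtrans_counit: "rtrans \<epsilon> x = x"
  using counit_right by (simp add: rtrans_def sweedler_def)

lemma ltrans_counit: "ltrans \<epsilon> x = x"
  using counit_left by (simp add: ltrans_def sweedler_def)

lemma rtrans_rtrans:
  assumes "functional f" "functional g"
  shows "rtrans f (rtrans g x) = rtrans (conv f g) x"
proof -
  have "rtrans f (rtrans g x) = sweedler scale (\<lambda>a b. scale (g b) (rtrans f a)) x"
    unfolding rtrans_def[of g] using linear_rtrans[OF assms(1)]
    by (simp add: linear_image_sweedler linear_map_scale)
  also have "\<dots> = sweedler scale (\<lambda>a c. sweedler scale (\<lambda>a b. scale (f b * g c) a) a) x"
    unfolding rtrans_def sweedler_scale[OF vector_space_axioms, symmetric] by (simp add: mult.commute)
  also have "\<dots> = sweedler scale (\<lambda>a b. sweedler scale (\<lambda>b c. scale (f b * g c) a) b) x"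
    using assms
    by (intro sweedler_coassoc) (simp add: trilin_iff functional_iff vector_space_axioms algebra_simps)
  also have "\<dots> = rtrans (conv f g) x"
    unfolding rtrans_def conv_def sweedler_scale_left[OF vector_space_axioms] ..
  finally show ?thesis .
qed

lemma ltrans_ltrans:
  assumes "functional f" "functional g"
  shows "ltrans f (ltrans g x) = ltrans (conv g f) x"
proof -
  have "ltrans f (ltrans g x) = sweedler scale (\<lambda>a b. scale (g a) (ltrans f b)) x"
    unfolding ltrans_def[of g] using linear_ltrans[OF assms(1)]
    by (simp add: linear_image_sweedler linear_map_scale)
  also have "\<dots> = sweedler scale (\<lambda>a b. sweedler scale (\<lambda>b c. scale (g a * f b) c) b) x"
    unfolding ltrans_def sweedler_scale[OF vector_space_axioms, symmetric] by simp
  also have "\<dots> = sweedler scale (\<lambda>a c. sweedler scale (\<lambda>a b. scale (g a * f b) c) a) x"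
    using assms
    by (intro sweedler_coassoc[symmetric])
      (simp add: trilin_iff functional_iff vector_space_axioms algebra_simps)
  also have "\<dots> = ltrans (conv g f) x"
    unfolding ltrans_def conv_def sweedler_scale_left[OF vector_space_axioms] ..
  finally show ?thesis .
qed

text \<open>The two translations use the outer legs of x_1 \<otimes> x_2 \<otimes> x_3 and keep the
  middle one, so coassociativity makes them commute.\<close>

lemma rtrans_ltrans:
  assumes "functional f" "functional g"
  shows "rtrans g (ltrans f x) = ltrans f (rtrans g x)"
proof -
  have "rtrans g (ltrans f x) = sweedler scale (\<lambda>a b. scale (f a) (rtrans g b)) x"
    unfolding ltrans_def[of f] using linear_rtrans[OF assms(2)]
    by (simp add: linear_image_sweedler linear_map_scale)
  also have "\<dots> = sweedler scale (\<lambda>a b. sweedler scale (\<lambda>b c. scale (f a * g c) b) b) x"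
    unfolding rtrans_def sweedler_scale[OF vector_space_axioms, symmetric] by simp
  also have "\<dots> = sweedler scale (\<lambda>a c. sweedler scale (\<lambda>a b. scale (f a * g c) b) a) x"
    using assms
    by (intro sweedler_coassoc[symmetric])
      (simp add: trilin_iff functional_iff vector_space_axioms algebra_simps)
  also have "\<dots> = sweedler scale (\<lambda>a b. scale (g b) (ltrans f a)) x"
    unfolding ltrans_def sweedler_scale[OF vector_space_axioms, symmetric] by (simp add: mult.commute)
  also have "\<dots> = ltrans f (rtrans g x)"
    unfolding rtrans_def[of g] using linear_ltrans[OF assms(1)]
    by (simp add: linear_image_sweedler linear_map_scale)
  finally show ?thesis .
qed

lemma rtrans_linear_simps:
  assumes "functional f"
  shows "rtrans f 0 = 0" "rtrans f (x + y) = rtrans f x + rtrans f y"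
    "rtrans f (x - y) = rtrans f x - rtrans f y" "rtrans f (scale c x) = scale c (rtrans f x)"
  using linear_rtrans[OF assms]
  by (simp_all add: linear_map_0 linear_map_add linear_map_diff linear_map_scale)

lemma functional_linear_simps:
  assumes "functional f"
  shows "f 0 = 0" "f (x + y) = f x + f y" "f (x - y) = f x - f y" "f (scale c x) = c * f x"
  using assms by (simp_all add: linear_map_0 linear_map_add linear_map_diff linear_map_scale)

lemmas counit_linear_simps = functional_linear_simps[OF functional_counit]

text \<open>A basis of W together with x is independent, so a functional may be prescribed as 0 on
  that basis and 1 at x.\<close>

lemma functional_separates_subspace:
  assumes "subspace W" "x \<notin> W"
  obtains f where "functional f" "\<And>w. w \<in> W \<Longrightarrow> f w = 0" "f x = 1"
proof -
  obtain B where B: "B \<subseteq> W" "independent B" "W \<subseteq> span B"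
    using maximal_independent_subset by blast
  have "span B = W"
    using B assms(1) by (simp add: span_subspace)
  then have ind: "independent (insert x B)"
    using B assms(2) by (simp add: independent_insertI)
  interpret p: vector_space_pair scale "(*) :: 'k \<Rightarrow> 'k \<Rightarrow> 'k"
    by (intro vector_space_pair.intro vector_space_axioms vector_space_mult)
  obtain f where f: "functional f" "\<forall>y\<in>insert x B. f y = (if y = x then 1 else 0)"
    using p.linear_independent_extend[OF ind, of "\<lambda>y. if y = x then 1 else 0"] by blast
  interpret f: Vector_Spaces.linear scale "(*)" f by (rule f(1))
  have "f b = 0" if "b \<in> B" for b
    using f(2) that B(1) assms(2) by auto
  then have "f w = 0" if "w \<in> W" for w
    using f.eq_0_on_span[of B w] that B(3) by blast
  then show ?thesis
    using f that by auto
qed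

lemma eq_0_if_functionals_vanish:
  assumes "\<And>f. functional f \<Longrightarrow> f x = 0"
  shows "x = 0"
proof (rule ccontr)
  assume "x \<noteq> 0"
  then obtain f where "functional f" "f x = 1"
    using functional_separates_subspace[of "{0}" x] by auto
  with assms[of f] show False by simp
qed

end

section \<open>Finite-dimensional subspaces\<close>

definition fin_dim :: "('k::field \<Rightarrow> 'v::ab_group_add \<Rightarrow> 'v) \<Rightarrow> 'v set \<Rightarrow> bool"
  where "fin_dim s V \<longleftrightarrow> (\<exists>X. finite X \<and> V \<subseteq> module.span s X)"

context vector_space
begin

lemma fin_dim_subset: "fin_dim scale V \<Longrightarrow> W \<subseteq> V \<Longrightarrow> fin_dim scale W"
  unfolding fin_dim_def by blast

lemma fin_dim_spanI: "finite X \<Longrightarrow> V \<subseteq> span X \<Longrightarrow> fin_dim scale V"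
  unfolding fin_dim_def by blast

lemma fin_dim_independent: "fin_dim scale V \<Longrightarrow> B \<subseteq> V \<Longrightarrow> independent B \<Longrightarrow> finite B"
  unfolding fin_dim_def using independent_span_bound by blast

lemma dim_strict_mono:
  assumes "fin_dim scale V" "subspace W" "subspace V" "W \<subset> V"
  shows "dim W < dim V"
proof -
  obtain B where B: "B \<subseteq> W" "independent B" "W \<subseteq> span B" "card B = dim W"
    using basis_exists by blast
  obtain C where C: "B \<subseteq> C" "C \<subseteq> V" "independent C" "V \<subseteq> span C"
    using maximal_independent_subset_extend[of B V] B assms(4) by blast
  have "B \<noteq> C"
    using B C assms by (metis psubset_eq span_subspace subset_trans)
  moreover have "finite C"
    using fin_dim_independent assms(1) C by blast
  ultimately have "card B < card C"
    using C(1) by (meson psubsetI psubset_card_mono)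
  then show ?thesis
    using B C basis_card_eq_dim[of C V] by simp
qed

lemma dim_mono_fin_dim: "fin_dim scale V \<Longrightarrow> subspace W \<Longrightarrow> subspace V \<Longrightarrow> W \<subseteq> V \<Longrightarrow> dim W \<le> dim V"
  using dim_strict_mono[of V W] by (cases "W = V") (auto simp: psubset_eq)

text \<open>A basis of W extends to a basis of V, and its nonempty part in W contributes nothing to
  the image.\<close>

lemma dim_image_less:
  assumes "Vector_Spaces.linear scale scale f" "fin_dim scale V" "subspace V" "subspace W" "W \<subseteq> V"
    "W \<noteq> {0}" "\<And>w. w \<in> W \<Longrightarrow> f w = 0"
  shows "fin_dim scale (f ` V)" "dim (f ` V) < dim V"
proof -
  interpret f: Vector_Spaces.linear scale scale f by fact
  obtain B where B: "B \<subseteq> W" "independent B" "W \<subseteq> span B"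
    using maximal_independent_subset by blast
  obtain C where C: "B \<subseteq> C" "C \<subseteq> V" "independent C" "V \<subseteq> span C"
    using maximal_independent_subset_extend[of B V] B assms(5) by blast
  have fin: "finite C"
    using fin_dim_independent assms(2) C by blast
  have "B \<noteq> {}"
    using B(3) assms(4,6) subspace_0 by fastforce
  have "f ` V \<subseteq> span (f ` C)"
    using C(4) f.spans_image by blast
  also have "f ` C \<subseteq> insert 0 (f ` (C - B))"
    using B(1) assms(7) by auto
  then have "span (f ` C) \<subseteq> span (f ` (C - B))"
    by (metis span_insert_0 span_mono)
  finally have sub: "f ` V \<subseteq> span (f ` (C - B))" .
  then show "fin_dim scale (f ` V)"
    using fin by (intro fin_dim_spanI[of "f ` (C - B)"]) auto
  have "dim (f ` V) \<le> card (f ` (C - B))"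
    using sub fin by (intro dim_le_card) auto
  also have "\<dots> \<le> card (C - B)"
    using fin by (intro card_image_le) auto
  also have "\<dots> < card C"
    using fin C(1) \<open>B \<noteq> {}\<close> by (intro psubset_card_mono) auto
  also have "card C = dim V"
    using basis_card_eq_dim C by blast
  finally show "dim (f ` V) < dim V" .
qed

end

section \<open>Coideals, subcoalgebras and connectedness\<close>

context coalgebra
begin

text \<open>Modulo the relators every tensor is a combination of u \<otimes> v with u, v from a
  fixed basis. The coefficients are values of pairs of coordinate functionals, so these pairs
  already detect a nonzero tensor.\<close>

lemma functionals_separate_tensors:
  assumes "\<And>f g. functional f \<Longrightarrow> functional g \<Longrightarrow>
    free_extend (*) (\<lambda>(a, b). f a * g b) s = free_extend (*) (\<lambda>(a, b). f a * g b) t"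
  shows "tensor2_eq scale s t"
proof -
  interpret k: vector_space "(*) :: 'k \<Rightarrow> 'k \<Rightarrow> 'k" by (rule vector_space_mult)
  define T where "T = tensor2_relators scale"
  define eqv where "eqv = tensor2_eq scale"
  obtain B where B: "independent B" "span B = UNIV"
    using independent_extend_basis[of "{}"] span_extend_basis[of "{}"] independent_empty by blast
  let ?r = "representation B"
  have eqv_iff: "eqv u v \<longleftrightarrow> u - v \<in> free_vs.span T" for u v
    by (simp add: eqv_def T_def tensor2_eq_def)
  have eqv_refl: "eqv u u" for u
    by (simp add: eqv_iff free_vs.span_zero)
  have eqv_trans: "eqv u w" if "eqv u v" "eqv v w" for u v w
    using free_vs.span_add[of "u - v" T "v - w"] that by (simp add: eqv_iff)
  have eqv_add: "eqv (u + u') (v + v')" if "eqv u v" "eqv u' v'" for u v u' v'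
    using free_vs.span_add[of "u - v" T "u' - v'"] that by (simp add: eqv_iff algebra_simps)
  have eqv_scale: "eqv (free_scale c u) (free_scale c v)" if "eqv u v" for u v c
    using free_vs.span_scale[of "u - v" T c] that
    by (simp add: eqv_iff free_vs.scale_right_diff_distrib)
  have eqv_sum: "eqv (sum u X) (sum v X)" if "\<And>x. x \<in> X \<Longrightarrow> eqv (u x) (v x)"
    for u v and X :: "'i set"
    using that by (induction X rule: infinite_finite_induct) (auto simp: eqv_refl intro!: eqv_add)
  have rel: "eqv (basis_vec (x + x', y)) (basis_vec (x, y) + basis_vec (x', y))"
      "eqv (basis_vec (x, y + y')) (basis_vec (x, y) + basis_vec (x, y'))"
      "eqv (basis_vec (scale c x, y)) (free_scale c (basis_vec (x, y)))"
      "eqv (basis_vec (x, scale c y)) (free_scale c (basis_vec (x, y)))" for x x' y y' c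
    unfolding eqv_iff T_def by (auto intro!: free_vs.span_base tensor2_relators.intros)
  have zero: "eqv (basis_vec (0, y)) 0" "eqv (basis_vec (x, 0)) 0" for x y
    using rel(3)[of 0 0 y] rel(4)[of x 0 0] by simp_all
  have left: "eqv (basis_vec (\<Sum>i\<in>X. scale (c i) i, y)) (\<Sum>i\<in>X. free_scale (c i) (basis_vec (i, y)))"
    for X c y
    by (induction X rule: infinite_finite_induct)
      (auto simp: zero intro: eqv_trans[OF rel(1)] eqv_add rel(3))
  have right: "eqv (basis_vec (x, \<Sum>i\<in>X. scale (c i) i)) (\<Sum>i\<in>X. free_scale (c i) (basis_vec (x, i)))"
    for X c x
    by (induction X rule: infinite_finite_induct)
      (auto simp: zero intro: eqv_trans[OF rel(2)] eqv_add rel(4))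
  define d where "d = s - t"
  define K where "K = Poly_Mapping.keys d"
  \<comment> \<open>Only the finitely many basis vectors that occur in a leg of \<open>d\<close>
    matter, so all expansions may run over the one finite set \<open>U\<close>.\<close>
  define U where "U = (\<Union>(a, b)\<in>K. {u. ?r a u \<noteq> 0} \<union> {u. ?r b u \<noteq> 0})"
  have finU: "finite U"
    unfolding U_def K_def by (auto intro!: finite_representation)
  have expand: "(\<Sum>u\<in>U. scale (?r a u) u) = a" if "\<And>u. ?r a u \<noteq> 0 \<Longrightarrow> u \<in> U" for a
  proof -
    have "(\<Sum>u\<in>U. scale (?r a u) u) = (\<Sum>u | ?r a u \<noteq> 0. scale (?r a u) u)"
      using finU that by (intro sum.mono_neutral_right) auto
    then show ?thesis
      using sum_nonzero_representation_eq[of B a] B by simp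
  qed
  have lin: "functional (\<lambda>x. ?r x u)" for u
    using B by (simp add: functional_iff representation_add representation_scale)
  have pair: "eqv (basis_vec (a, b))
      (\<Sum>u\<in>U. \<Sum>v\<in>U. free_scale (?r a u * ?r b v) (basis_vec (u, v)))"
    if "(a, b) \<in> K" for a b
  proof -
    have ea: "(\<Sum>u\<in>U. scale (?r a u) u) = a" and eb: "(\<Sum>u\<in>U. scale (?r b u) u) = b"
      using that by - (rule expand; force simp: U_def)+
    have "eqv (basis_vec (a, b)) (\<Sum>u\<in>U. free_scale (?r a u) (basis_vec (u, b)))"
      using left[of "?r a" U b] unfolding ea .
    moreover have "eqv (\<Sum>u\<in>U. free_scale (?r a u) (basis_vec (u, b)))
        (\<Sum>u\<in>U. free_scale (?r a u) (\<Sum>v\<in>U. free_scale (?r b v) (basis_vec (u, v))))"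
      using right[of _ "?r b" U] unfolding eb by (intro eqv_sum eqv_scale)
    ultimately have "eqv (basis_vec (a, b))
        (\<Sum>u\<in>U. free_scale (?r a u) (\<Sum>v\<in>U. free_scale (?r b v) (basis_vec (u, v))))"
      by (rule eqv_trans)
    then show ?thesis
      by (simp add: free_vs.scale_sum_right)
  qed
  have "d = (\<Sum>p\<in>K. free_scale (Poly_Mapping.lookup d p) (basis_vec p))"
  proof (rule poly_mapping_eqI)
    show "Poly_Mapping.lookup d q =
        Poly_Mapping.lookup (\<Sum>p\<in>K. free_scale (Poly_Mapping.lookup d p) (basis_vec p)) q" for q
    proof -
      have "Poly_Mapping.lookup (\<Sum>p\<in>K. free_scale (Poly_Mapping.lookup d p) (basis_vec p)) q
          = (\<Sum>p\<in>K. if p = q then Poly_Mapping.lookup d p else 0)"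
        unfolding lookup_sum lookup_free_scale by (rule sum.cong) (auto simp: lookup_single when_def)
      then show ?thesis
        by (simp add: K_def in_keys_iff)
    qed
  qed
  also have "eqv \<dots> (\<Sum>p\<in>K. free_scale (Poly_Mapping.lookup d p)
      (\<Sum>u\<in>U. \<Sum>v\<in>U. free_scale (?r (fst p) u * ?r (snd p) v) (basis_vec (u, v))))"
    using pair[of "fst p" "snd p" for p] by (intro eqv_sum eqv_scale) simp
  also have "\<dots> = (\<Sum>u\<in>U. \<Sum>v\<in>U. free_scale
      (free_extend (*) (\<lambda>(a, b). ?r a u * ?r b v) d) (basis_vec (u, v)))"
  proof -
    let ?g = "\<lambda>p u v. free_scale (Poly_Mapping.lookup d p)
      (free_scale (?r (fst p) u * ?r (snd p) v) (basis_vec (u, v)))"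
    have "(\<Sum>p\<in>K. \<Sum>u\<in>U. \<Sum>v\<in>U. ?g p u v) = (\<Sum>u\<in>U. \<Sum>p\<in>K. \<Sum>v\<in>U. ?g p u v)"
      by (rule sum.swap)
    also have "\<dots> = (\<Sum>u\<in>U. \<Sum>v\<in>U. \<Sum>p\<in>K. ?g p u v)"
      by (intro sum.cong refl sum.swap)
    finally show ?thesis
      by (simp only: free_vs.scale_sum_right free_extend_def K_def[symmetric] case_prod_unfold
          free_vs.scale_sum_left free_vs.scale_scale)
  qed
  also have "\<dots> = 0"
  proof -
    have "free_extend (*) (\<lambda>(a, b). ?r a u * ?r b v) d = 0" for u v
      using assms[OF lin lin, of u v] by (simp add: d_def k.free_extend_diff)
    then show ?thesis by simp
  qed
  finally have "eqv d 0" .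
  then show ?thesis
    by (simp add: d_def eqv_iff tensor2_eq_def T_def)
qed

text \<open>Pairing the right leg of \<Delta> x with every functional expresses that \<Delta> V lies
  in V \<otimes> C, where C is the whole coalgebra.\<close>

definition right_coideal :: "'c set \<Rightarrow> bool"
  where "right_coideal V \<longleftrightarrow> subspace V \<and> (\<forall>f x. functional f \<and> x \<in> V \<longrightarrow> rtrans f x \<in> V)"

text \<open>For a projection p onto C the required tensor is (p \<otimes> p)(\<Delta> x). Stability
  under \<open>rtrans\<close> allows p to be inserted in the left leg, stability under
  \<open>ltrans\<close> in the right leg, and pairs of functionals separate tensors.\<close>

lemma subcoalgebraI:
  assumes "right_coideal C" "\<And>f x. functional f \<Longrightarrow> x \<in> C \<Longrightarrow> ltrans f x \<in> C"
  shows "subcoalgebra C"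
  unfolding subcoalgebra_def
proof (intro conjI ballI)
  show C: "subspace C"
    using assms(1) by (simp add: right_coideal_def)
  obtain B where B: "B \<subseteq> C" "independent B" "C \<subseteq> span B"
    using maximal_independent_subset by blast
  interpret p: vector_space_pair scale scale
    by (intro vector_space_pair.intro vector_space_axioms)
  obtain p where p: "range p \<subseteq> C" "\<And>x. x \<in> C \<Longrightarrow> p x = x" "Vector_Spaces.linear scale scale p"
  proof -
    have "inj_on id C" by simp
    obtain g where g: "range g \<subseteq> C" "\<forall>v\<in>C. g (id v) = v" "Vector_Spaces.linear scale scale g"
      using p.linear_exists_left_inverse_on[of id C] C linear_id by auto
    then show thesis using that by simp
  qed
  interpret k: vector_space "(*) :: 'k \<Rightarrow> 'k \<Rightarrow> 'k" by (rule vector_space_mult)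
  fix x assume x: "x \<in> C"
  let ?t = "free_extend free_scale (\<lambda>(a, b). basis_vec (p a, p b)) (\<Delta> x)"
  have "Poly_Mapping.keys ?t \<subseteq> C \<times> C"
  proof -
    have "Poly_Mapping.keys ?t \<subseteq>
        (\<Union>(a, b)\<in>Poly_Mapping.keys (\<Delta> x). Poly_Mapping.keys
          (free_scale (Poly_Mapping.lookup (\<Delta> x) (a, b)) (basis_vec (p a, p b) :: 'c \<times> 'c \<Rightarrow>\<^sub>0 'k)))"
      unfolding free_extend_def using keys_sum by (force simp: case_prod_unfold)
    also have "\<dots> \<subseteq> C \<times> C"
      using p(1) by (fastforce simp: in_keys_iff lookup_single when_def split: if_splits)
    finally show ?thesis .
  qed
  moreover have "tensor2_eq scale (\<Delta> x) ?t"
  proof (rule functionals_separate_tensors)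
    fix f g assume f: "functional f" and g: "functional g"
    have fp: "functional (\<lambda>x. f (p x))" and gp: "functional (\<lambda>x. g (p x))"
      using linear_map_comp[OF f p(3)] linear_map_comp[OF g p(3)] .
    have r: "rtrans g x \<in> C"
      using x assms(1) g by (simp add: right_coideal_def)
    have l: "ltrans (\<lambda>x. f (p x)) x \<in> C"
      using x assms(2) fp by simp
    have "conv f g x = f (p (rtrans g x))"
      using r by (simp add: p(2) functional_rtrans[OF f])
    also have "\<dots> = g (ltrans (\<lambda>x. f (p x)) x)"
      using functional_rtrans[OF fp, of g x] functional_ltrans[OF g, of "\<lambda>x. f (p x)" x] by simp
    also have "\<dots> = g (p (ltrans (\<lambda>x. f (p x)) x))"
      using l by (simp add: p(2))
    also have "\<dots> = conv (\<lambda>x. f (p x)) (\<lambda>x. g (p x)) x"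
      using functional_ltrans[OF gp] .
    finally show "free_extend (*) (\<lambda>(a, b). f a * g b) (\<Delta> x) = free_extend (*) (\<lambda>(a, b). f a * g b) ?t"
      unfolding free_extend_free_extend[OF vector_space_mult] conv_def sweedler_def
      by (simp add: case_prod_unfold)
  qed
  ultimately show "\<exists>t. Poly_Mapping.keys t \<subseteq> C \<times> C \<and> tensor2_eq scale (\<Delta> x) t"
    by blast
qed

text \<open>Whatever the functional, a translate of x is a combination of the finitely many left
  legs of the representative \<open>\<Delta> x\<close>.\<close>

lemma rtrans_orbit_fin_dim:
  assumes "finite X"
  shows "fin_dim scale (\<Union>f. rtrans f ` X)"
proof -
  let ?Y = "\<Union>x\<in>X. fst ` Poly_Mapping.keys (\<Delta> x)"
  have "rtrans f x \<in> span ?Y" if "x \<in> X" for f x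
    unfolding rtrans_def sweedler_def free_extend_def case_prod_unfold
    using that by (intro span_sum span_scale span_base) auto
  then show ?thesis
    using assms by (intro fin_dim_spanI[of ?Y]) auto
qed

lemma ltrans_orbit_fin_dim:
  assumes "finite X"
  shows "fin_dim scale (\<Union>f. ltrans f ` X)"
proof -
  let ?Y = "\<Union>x\<in>X. snd ` Poly_Mapping.keys (\<Delta> x)"
  have "ltrans f x \<in> span ?Y" if "x \<in> X" for f x
    unfolding ltrans_def sweedler_def free_extend_def case_prod_unfold
    using that by (intro span_sum span_scale span_base) auto
  then show ?thesis
    using assms by (intro fin_dim_spanI[of ?Y]) auto
qed

lemma ltrans_image_fin_dim:
  assumes "fin_dim scale V"
  shows "fin_dim scale (\<Union>f\<in>Collect functional. ltrans f ` V)"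
proof -
  obtain X where X: "finite X" "V \<subseteq> span X"
    using assms unfolding fin_dim_def by blast
  obtain Y where Y: "finite Y" "(\<Union>f. ltrans f ` X) \<subseteq> span Y"
    using ltrans_orbit_fin_dim[OF X(1)] unfolding fin_dim_def by blast
  have "ltrans f ` V \<subseteq> span Y" if "functional f" for f
  proof -
    interpret l: Vector_Spaces.linear scale scale "ltrans f"
      using that by (rule linear_ltrans)
    have "ltrans f ` V \<subseteq> span (ltrans f ` X)"
      using X(2) l.spans_image by blast
    also have "\<dots> \<subseteq> span Y"
      using Y(2) by (intro span_minimal) auto
    finally show ?thesis .
  qed
  then show ?thesis
    using Y(1) unfolding fin_dim_def by blast
qed

lemma right_coideal_span:
  assumes "\<And>f x. functional f \<Longrightarrow> x \<in> X \<Longrightarrow> rtrans f x \<in> span X"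
  shows "right_coideal (span X)"
  unfolding right_coideal_def
proof (intro conjI allI impI)
  fix f x assume "functional f \<and> x \<in> span X"
  then have f: "functional f" and x: "x \<in> span X" by auto
  interpret l: Vector_Spaces.linear scale scale "rtrans f"
    using f by (rule linear_rtrans)
  have "rtrans f x \<in> span (rtrans f ` X)"
    using x l.span_image by blast
  also have "\<dots> \<subseteq> span X"
    using assms f by (intro span_minimal) auto
  finally show "rtrans f x \<in> span X" .
qed simp

text \<open>The translates of x span such a coideal: convolution closes them under translation, the
  counit returns x, and the legs of \<Delta> x bound the dimension.\<close>

lemma fin_dim_right_coideal_exists:
  obtains W where "right_coideal W" "fin_dim scale W" "x \<in> W"
proof
  let ?X = "{rtrans f x |f. functional f}"
  show "right_coideal (span ?X)"
    by (rule right_coideal_span) (auto simp: rtrans_rtrans functional_conv intro!: span_base)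
  obtain Y where "finite Y" "(\<Union>f. rtrans f ` {x}) \<subseteq> span Y"
    using rtrans_orbit_fin_dim[of "{x}"] unfolding fin_dim_def by blast
  then show "fin_dim scale (span ?X)"
    by (intro fin_dim_spanI[of Y] span_minimal) auto
  have "rtrans \<epsilon> x \<in> span ?X"
    using functional_counit by (intro span_base) blast
  then show "x \<in> span ?X"
    by (simp add: rtrans_counit)
qed

lemma right_coideal_ltrans_image:
  assumes "right_coideal V" "functional g"
  shows "right_coideal (ltrans g ` V)"
proof -
  interpret l: Vector_Spaces.linear scale scale "ltrans g"
    using assms(2) by (rule linear_ltrans)
  show ?thesis
    using assms l.subspace_image by (auto simp: right_coideal_def rtrans_ltrans)
qed

text \<open>A nonzero subcoalgebra of least dimension inside C is simple.\<close>

lemma simple_subcoalgebra_exists: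
  assumes "subcoalgebra C" "fin_dim scale C" "C \<noteq> {0}"
  obtains D where "simple_subcoalgebra D" "D \<subseteq> C"
proof -
  define P where "P D \<longleftrightarrow> subcoalgebra D \<and> D \<subseteq> C \<and> D \<noteq> {0}" for D
  have "P C" using assms by (simp add: P_def)
  then obtain D where D: "P D" "\<And>E. P E \<Longrightarrow> dim D \<le> dim E"
    using ex_has_least_nat[of P C dim] by blast
  have "E = {0} \<or> E = D" if "subcoalgebra E" "E \<subseteq> D" for E
  proof (rule ccontr)
    assume E: "\<not> (E = {0} \<or> E = D)"
    then have "dim E < dim D"
      using that D(1) assms(2) fin_dim_subset
      by (intro dim_strict_mono) (auto simp: P_def subcoalgebra_def)
    moreover have "P E"
      using E that D(1) by (auto simp: P_def)
    ultimately show False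
      using D(2) by fastforce
  qed
  then show ?thesis
    using that[of D] D(1) by (simp add: simple_subcoalgebra_def P_def)
qed

end

section \<open>The coradical filtration of a connected Hopf algebra\<close>

context bialgebra
begin

lemma sweedler_one:
  assumes "bilin s \<beta>"
  shows "sweedler s \<beta> 1 = \<beta> 1 1"
proof -
  interpret s: vector_space s using assms by (rule bilin_target)
  show ?thesis
    using free_extend_tensor2_eq[OF comult_one assms] by (simp add: sweedler_def)
qed

lemma rtrans_one: "functional f \<Longrightarrow> rtrans f 1 = scale (f 1) 1"
  unfolding rtrans_def
  by (rule sweedler_one) (simp add: bilin_iff functional_iff vector_space_axioms algebra_simps)

lemma conv_one: "functional f \<Longrightarrow> functional g \<Longrightarrow> conv f g 1 = f 1 * g 1"
  unfolding conv_def
  by (rule sweedler_one) (simp add: bilin_iff functional_iff vector_space_mult algebra_simps)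

lemma counit_scale_one [simp]: "\<epsilon> (scale c 1) = c"
  by (simp add: counit_linear_simps counit_one)

text \<open>The kernel of the augmentation f -> f 1 of the convolution algebra. For connected H it
  is the annihilator of the coradical.\<close>

definition aug_dual :: "('h \<Rightarrow> 'k) set"
  where "aug_dual = {f. functional f \<and> f 1 = 0}"

lemma aug_dual_functional: "f \<in> aug_dual \<Longrightarrow> functional f"
  by (simp add: aug_dual_def)

lemma conv_aug_dual_left: "f \<in> aug_dual \<Longrightarrow> functional g \<Longrightarrow> conv f g \<in> aug_dual"
  and conv_aug_dual_right: "functional f \<Longrightarrow> g \<in> aug_dual \<Longrightarrow> conv f g \<in> aug_dual"
  by (simp_all add: aug_dual_def functional_conv conv_one)

text \<open>As \<epsilon> is the unit for convolution, this is the component of f in the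
  augmentation ideal.\<close>

lemma functional_sub_counit_aug_dual: "functional f \<Longrightarrow> (\<lambda>x. f x - f 1 * \<epsilon> x) \<in> aug_dual"
  using functional_counit by (simp add: aug_dual_def functional_iff counit_one algebra_simps)

lemma rtrans_sub_counit: "rtrans (\<lambda>x. f x - c * \<epsilon> x) x = rtrans f x - scale c x"
proof -
  have "rtrans (\<lambda>x. f x - c * \<epsilon> x) x =
      sweedler scale (\<lambda>a b. scale (f b) a - scale c (scale (\<epsilon> b) a)) x"
    unfolding rtrans_def by (simp only: scale_left_diff_distrib scale_scale)
  also have "\<dots> = rtrans f x - scale c (rtrans \<epsilon> x)"
    unfolding rtrans_def
    by (simp only: sweedler_diff[OF vector_space_axioms] sweedler_scale[OF vector_space_axioms])
  finally show ?thesis by (simp add: rtrans_counit)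
qed

lemma ltrans_sub_counit: "ltrans (\<lambda>x. f x - c * \<epsilon> x) x = ltrans f x - scale c x"
proof -
  have "ltrans (\<lambda>x. f x - c * \<epsilon> x) x =
      sweedler scale (\<lambda>a b. scale (f a) b - scale c (scale (\<epsilon> a) b)) x"
    unfolding ltrans_def scale_scale scale_left_diff_distrib[symmetric] ..
  also have "\<dots> = ltrans f x - scale c (ltrans \<epsilon> x)"
    unfolding ltrans_def
    by (simp only: sweedler_diff[OF vector_space_axioms] sweedler_scale[OF vector_space_axioms])
  finally show ?thesis by (simp add: ltrans_counit)
qed

text \<open>\<open>filt (Suc n)\<close> is the \<open>n\<close>-th term of the coradical filtration.\<close>

primrec filt :: "nat \<Rightarrow> 'h set"
  where
    "filt 0 = {0}"
  | "filt (Suc n) = {x. \<forall>f\<in>aug_dual. rtrans f x \<in> filt n}"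

lemma filt_subspace: "subspace (filt n)"
proof (induction n)
  case (Suc n)
  then show ?case
    by (auto intro!: subspaceI simp: aug_dual_functional rtrans_linear_simps
        subspace_0 subspace_add subspace_scale)
qed simp

lemma filt_Suc_mono: "filt n \<subseteq> filt (Suc n)"
  by (induction n) (auto simp: rtrans_linear_simps aug_dual_functional)

lemma filt_mono: "m \<le> n \<Longrightarrow> filt m \<subseteq> filt n"
  by (rule lift_Suc_mono_le[of filt, OF filt_Suc_mono])

lemma one_mem_filt: "1 \<in> filt (Suc n)"
proof -
  have "1 \<in> filt (Suc 0)"
    by (auto simp: rtrans_one aug_dual_def)
  then show ?thesis
    using filt_mono[of "Suc 0" "Suc n"] by (auto simp del: filt.simps)
qed

text \<open>If \<open>aug_dual\<close> kills x, every f translates x to f 1 times x. Applying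
  \<epsilon> gives f x = f 1 * \<epsilon> x for all f, and functionals separate points.\<close>

lemma filt_1: "x \<in> filt (Suc 0) \<Longrightarrow> x = scale (\<epsilon> x) 1"
proof -
  assume x: "x \<in> filt (Suc 0)"
  have r: "rtrans f x = scale (f 1) x" if "functional f" for f
    using x functional_sub_counit_aug_dual[OF that] by (force simp: rtrans_sub_counit)
  have "f (x - scale (\<epsilon> x) 1) = 0" if f: "functional f" for f
  proof -
    have "f x = \<epsilon> (rtrans f x)"
      using functional_ltrans[OF f, of \<epsilon> x] functional_rtrans[OF functional_counit, of f x]
      by (simp add: ltrans_counit)
    also have "\<dots> = f 1 * \<epsilon> x"
      by (simp add: r[OF f] counit_linear_simps)
    finally show ?thesis
      using f by (simp add: functional_linear_simps)
  qed
  then have "x - scale (\<epsilon> x) 1 = 0"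
    by (rule eq_0_if_functionals_vanish)
  then show ?thesis by simp
qed

text \<open>The filtration is defined through the right leg only. Since left and right translations
  commute, induction carries the drop in degree over to the left leg.\<close>

lemma ltrans_filt_Suc:
  assumes "f \<in> aug_dual"
  shows "x \<in> filt (Suc n) \<Longrightarrow> ltrans f x \<in> filt n"
proof (induction n arbitrary: x)
  case 0
  let ?l = "ltrans f"
  have lin: "Vector_Spaces.linear scale scale ?l"
    using assms by (intro linear_ltrans aug_dual_functional)
  have "x = scale (\<epsilon> x) 1"
    using 0 by (rule filt_1)
  then have "?l x = scale (\<epsilon> x) (?l 1)"
    using linear_map_scale[OF lin] by metis
  moreover have "?l 1 = 0"
  proof -
    have "?l 1 = scale (f 1) 1"
      unfolding ltrans_def using aug_dual_functional[OF assms]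
      by (intro sweedler_one) (simp add: bilin_iff functional_iff vector_space_axioms algebra_simps)
    then show ?thesis using assms by (simp add: aug_dual_def)
  qed
  ultimately show ?case by simp
next
  case (Suc n)
  then have "ltrans f (rtrans g x) \<in> filt n" if "g \<in> aug_dual" for g
    using that by (metis (mono_tags, lifting) filt.simps(2) mem_Collect_eq)
  then show ?case
    using assms by (simp add: rtrans_ltrans aug_dual_functional)
qed

lemma ltrans_filt:
  assumes "functional f" "x \<in> filt n"
  shows "ltrans f x \<in> filt n"
proof (cases n)
  case 0
  then show ?thesis
    using assms by (simp add: linear_map_0[OF linear_ltrans])
next
  case (Suc m)
  have "ltrans (\<lambda>x. f x - f 1 * \<epsilon> x) x \<in> filt m"
    using assms Suc by (intro ltrans_filt_Suc functional_sub_counit_aug_dual) auto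
  then have "ltrans f x - scale (f 1) x \<in> filt n"
    using filt_Suc_mono[of m] Suc by (auto simp: ltrans_sub_counit)
  then have "(ltrans f x - scale (f 1) x) + scale (f 1) x \<in> filt n"
    by (intro subspace_add[OF filt_subspace] subspace_scale[OF filt_subspace] assms(2))
  then show ?thesis by simp
qed

text \<open>The dual form of the compatibility of \<Delta> with the filtration: a functional that
  does not see the first i layers removes i layers. In the induction step \<open>conv g f\<close>
  misses one layer more, because \<open>ltrans g\<close> lowers the filtration by one.\<close>

lemma rtrans_filt_if_vanishes:
  assumes "functional f" "\<And>y. y \<in> filt i \<Longrightarrow> f y = 0" "x \<in> filt (i + n)"
  shows "rtrans f x \<in> filt n"
  using assms
proof (induction n arbitrary: i f)
  case 0
  have "g (rtrans f x) = 0" if g: "functional g" for g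
    using functional_rtrans[OF g, of f x] functional_ltrans[OF 0(1), of g x]
      0(2)[of "ltrans g x"] ltrans_filt[OF g, of x i] 0(3) by simp
  then show ?case
    using eq_0_if_functionals_vanish by simp
next
  case (Suc n)
  have "rtrans (conv g f) x \<in> filt n" if g: "g \<in> aug_dual" for g
  proof (rule Suc.IH)
    show "functional (conv g f)"
      using g Suc.prems(1) by (simp add: functional_conv aug_dual_functional)
    show "x \<in> filt (Suc i + n)"
      using Suc.prems(3) by simp
    show "conv g f y = 0" if "y \<in> filt (Suc i)" for y
      using functional_ltrans[OF Suc.prems(1), of g y] Suc.prems(2) ltrans_filt_Suc[OF g that] by simp
  qed
  then show ?case
    using Suc.prems(1) by (simp add: rtrans_rtrans aug_dual_functional)
qed

lemma conv_eq_0_on_filt: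
  assumes "functional f" "\<And>y. y \<in> filt i \<Longrightarrow> f y = 0"
    "functional g" "\<And>y. y \<in> filt j \<Longrightarrow> g y = 0" "n \<le> i + j" "x \<in> filt n"
  shows "conv f g x = 0"
proof -
  have "x \<in> filt (j + i)"
    using assms(5,6) filt_mono[of n "j + i"] by auto
  then have "rtrans g x \<in> filt i"
    using assms(3,4) by (intro rtrans_filt_if_vanishes)
  then show ?thesis
    using assms(2) functional_rtrans[OF assms(1), of g x] by simp
qed

text \<open>Here the index is the true degree, whereas \<open>filt\<close> is shifted by one: the
  coradical is \<open>filt 1\<close>.\<close>

definition aug_filt :: "nat \<Rightarrow> 'h set"
  where "aug_filt n = {x \<in> filt (Suc n). \<epsilon> x = 0}"

lemma aug_filt_subspace: "subspace (aug_filt n)"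
  using filt_subspace[of "Suc n"]
  by (intro subspaceI) (auto simp: aug_filt_def counit_linear_simps
      subspace_0 subspace_add subspace_scale simp del: filt.simps)

lemma aug_filt_0: "aug_filt 0 = {0}"
proof -
  have "x = 0" if "x \<in> filt (Suc 0)" "\<epsilon> x = 0" for x
    using filt_1[OF that(1)] that(2) by simp
  then show ?thesis
    using subspace_0[OF aug_filt_subspace[of 0]] unfolding aug_filt_def by blast
qed

lemma aug_filt_mono: "m \<le> n \<Longrightarrow> aug_filt m \<subseteq> aug_filt n"
  using filt_mono[of "Suc m" "Suc n"] by (auto simp: aug_filt_def simp del: filt.simps)

lemma aug_filt_subset: "aug_filt n \<subseteq> filt (Suc n)"
  by (auto simp: aug_filt_def)

lemma sub_counit_aug_filt: "x \<in> filt (Suc n) \<Longrightarrow> x - scale (\<epsilon> x) 1 \<in> aug_filt n"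
  using one_mem_filt[of n]
  by (auto simp: aug_filt_def counit_linear_simps counit_one simp del: filt.simps
      intro!: subspace_diff[OF filt_subspace] subspace_scale[OF filt_subspace])

text \<open>Nested bases give every basis vector a degree, such that its coordinate functional
  vanishes in lower degrees. This is what \<open>comult_filtered\<close> needs.\<close>

lemma adapted_basis:
  obtains B where "\<And>n. B n \<subseteq> B (Suc n)" "\<And>n. independent (B n)"
    "\<And>n. B n \<subseteq> aug_filt n" "\<And>n. aug_filt n \<subseteq> span (B n)"
proof -
  define P where "P n b \<longleftrightarrow> independent b \<and> b \<subseteq> aug_filt n \<and> aug_filt n \<subseteq> span b" for n b
  have "\<exists>B. \<forall>n. P n (B n) \<and> B n \<subseteq> B (Suc n)"
  proof (rule dependent_nat_choice)
    show "\<exists>b. P 0 b"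
    proof -
      obtain b where "b \<subseteq> aug_filt 0" "independent b" "aug_filt 0 \<subseteq> span b"
        by (rule maximal_independent_subset)
      then show ?thesis
        by (auto simp: P_def)
    qed
    show "\<exists>c. P (Suc n) c \<and> b \<subseteq> c" if "P n b" for b n
    proof -
      have "b \<subseteq> aug_filt (Suc n)" "independent b"
        using that aug_filt_mono[of n "Suc n"] by (auto simp: P_def)
      then obtain c where "b \<subseteq> c" "c \<subseteq> aug_filt (Suc n)" "independent c" "aug_filt (Suc n) \<subseteq> span c"
        by (rule maximal_independent_subset_extend)
      then show ?thesis
        by (auto simp: P_def)
    qed
  qed
  then obtain B where "\<And>n. P n (B n) \<and> B n \<subseteq> B (Suc n)"
    by blast
  then show ?thesis
    using that[of B] by (simp add: P_def)
qed

end

section \<open>Exhaustiveness of the filtration under connectedness\<close>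

context connected_hopf_algebra
begin

text \<open>The submodule J V for the augmentation ideal J of the dual algebra, which plays the part
  of the radical in Nakayama's lemma.\<close>

definition aug_act :: "'h set \<Rightarrow> 'h set"
  where "aug_act V = span (\<Union>f\<in>aug_dual. rtrans f ` V)"

text \<open>A simple subcoalgebra of C lies in the coradical, which is spanned by 1, so any nonzero
  element of it is an invertible multiple of 1.\<close>

lemma one_mem_subcoalgebra:
  assumes "subcoalgebra C" "fin_dim scale C" "C \<noteq> {0}"
  shows "1 \<in> C"
proof -
  obtain D where D: "simple_subcoalgebra D" "D \<subseteq> C"
    using simple_subcoalgebra_exists[OF assms] .
  have sub: "subspace D" "D \<noteq> {0}"
    using D(1) by (auto simp: simple_subcoalgebra_def subcoalgebra_def)
  then obtain x where x: "x \<in> D" "x \<noteq> 0"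
    using subspace_0 by blast
  have "x \<in> \<Union>{C. simple_subcoalgebra C}"
    using D(1) x(1) by blast
  then have "x \<in> coradical"
    unfolding coradical_def by (rule span_base)
  then obtain c where c: "x = scale c 1"
    unfolding connected by blast
  then have "c \<noteq> 0"
    using x(2) by auto
  then have "1 = scale (inverse c) x"
    by (simp add: c)
  also have "\<dots> \<in> C"
    using subspace_scale[OF sub(1) x(1)] D(2) by blast
  finally show ?thesis .
qed

lemma aug_act_subset: "right_coideal V \<Longrightarrow> aug_act V \<subseteq> V"
  unfolding aug_act_def right_coideal_def
  by (intro span_minimal UN_least image_subsetI) (simp_all add: aug_dual_functional)

lemma right_coideal_aug_act:
  assumes "right_coideal V"
  shows "right_coideal (aug_act V)"
  unfolding aug_act_def
proof (rule right_coideal_span)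
  fix g x assume g: "functional g" and "x \<in> (\<Union>f\<in>aug_dual. rtrans f ` V)"
  then obtain f v where f: "f \<in> aug_dual" "v \<in> V" "x = rtrans f v" by auto
  have "rtrans g x = rtrans (conv g f) v"
    using g f by (simp add: rtrans_rtrans aug_dual_functional)
  moreover have "conv g f \<in> aug_dual"
    using g f conv_aug_dual_right by blast
  ultimately show "rtrans g x \<in> span (\<Union>f\<in>aug_dual. rtrans f ` V)"
    using f(2) by (intro span_base) force
qed

lemma aug_act_ltrans_image:
  assumes "functional g"
  shows "aug_act (ltrans g ` V) = ltrans g ` aug_act V"
proof -
  interpret l: Vector_Spaces.linear scale scale "ltrans g"
    using assms by (rule linear_ltrans)
  have "rtrans f ` ltrans g ` V = ltrans g ` rtrans f ` V" if "f \<in> aug_dual" for f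
    using rtrans_ltrans[OF assms aug_dual_functional[OF that]] by (simp add: image_image)
  then have "(\<Union>f\<in>aug_dual. rtrans f ` ltrans g ` V) = ltrans g ` (\<Union>f\<in>aug_dual. rtrans f ` V)"
    unfolding image_UN by (intro SUP_cong refl)
  then show ?thesis
    unfolding aug_act_def by (simp add: l.span_image)
qed

text \<open>
  Nakayama's lemma for right coideals. A counterexample of minimal dimension is a simple right
  coideal \<open>N\<close>: a functional killing a proper subcoideal would translate \<open>N\<close> to a smaller
  counterexample. The left translates of \<open>N\<close> span a subcoalgebra, which contains \<open>1\<close> by
  connectedness; this makes \<open>N\<close> isomorphic to the trivial coideal \<open>k1\<close>.
\<close>

lemma smaller_perfect_right_coideal:
  assumes N: "right_coideal N" "fin_dim scale N" "aug_act N = N"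
    and E: "right_coideal E" "E \<subset> N" "E \<noteq> {0}"
  obtains M where "right_coideal M" "fin_dim scale M" "aug_act M = M" "M \<noteq> {0}" "dim M < dim N"
proof -
  have sub: "subspace E" "subspace N"
    using E(1) N(1) by (auto simp: right_coideal_def)
  obtain x where x: "x \<in> N" "x \<notin> E"
    using E(2) by blast
  obtain g where g: "functional g" "\<And>w. w \<in> E \<Longrightarrow> g w = 0" "g x = 1"
    using functional_separates_subspace[OF sub(1) x(2)] by blast
  \<comment> \<open>Testing with f gives f (ltrans g w) = g (rtrans f w), where
    \<open>rtrans f w\<close> stays in \<open>E\<close> and is killed by \<open>g\<close>.\<close>
  have "ltrans g w = 0" if "w \<in> E" for w
  proof (rule eq_0_if_functionals_vanish)
    fix f assume f: "functional f"
    have "f (ltrans g w) = g (rtrans f w)"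
      using functional_ltrans[OF f] functional_rtrans[OF g(1)] by simp
    then show "f (ltrans g w) = 0"
      using g(2) E(1) f that by (simp add: right_coideal_def)
  qed
  then have dims: "fin_dim scale (ltrans g ` N)" "dim (ltrans g ` N) < dim N"
    using dim_image_less[OF linear_ltrans[OF g(1)] N(2) sub(2) sub(1) _ E(3)] E(2) by auto
  \<comment> \<open>The counit evaluates \<open>ltrans g x\<close> to g x = 1, so the translate of N
    is not zero.\<close>
  have "\<epsilon> (ltrans g x) = g (rtrans \<epsilon> x)"
    using functional_ltrans[OF functional_counit] functional_rtrans[OF g(1)] by simp
  then have "ltrans g x \<noteq> 0"
    using g(3) counit_linear_simps(1) by (auto simp: rtrans_counit)
  then have "ltrans g ` N \<noteq> {0}"
    using x(1) by blast
  then show ?thesis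
    using that[of "ltrans g ` N"] dims N right_coideal_ltrans_image[OF N(1) g(1)]
      aug_act_ltrans_image[OF g(1), of N] by simp
qed

text \<open>Left translates are stable under right translation because the two commute, and under
  left translation because they compose by convolution. Translating by \<epsilon> shows that N is
  contained.\<close>

lemma subcoalgebra_span_ltrans:
  assumes "right_coideal N" "fin_dim scale N"
  defines "X \<equiv> \<Union>f\<in>Collect functional. ltrans f ` N"
  shows "subcoalgebra (span X)" "right_coideal (span X)" "fin_dim scale (span X)" "N \<subseteq> span X"
proof -
  have X_I: "ltrans g n \<in> X" if "functional g" "n \<in> N" for g n
    using that by (auto simp: X_def)
  have X_E: "\<exists>g n. functional g \<and> n \<in> N \<and> x = ltrans g n" if "x \<in> X" for x
    using that by (auto simp: X_def)
  show co: "right_coideal (span X)"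
  proof (rule right_coideal_span)
    fix f x assume f: "functional f" and "x \<in> X"
    then obtain g n where g: "functional g" "n \<in> N" "x = ltrans g n"
      using X_E by blast
    have "rtrans f n \<in> N"
      using assms(1) f g(2) by (simp add: right_coideal_def)
    then show "rtrans f x \<in> span X"
      using X_I[OF g(1)] rtrans_ltrans[OF g(1) f] g(3) by (simp add: span_base)
  qed
  show "subcoalgebra (span X)"
  proof (rule subcoalgebraI[OF co])
    fix f x assume f: "functional f" and x: "x \<in> span X"
    interpret l: Vector_Spaces.linear scale scale "ltrans f"
      using f by (rule linear_ltrans)
    have "ltrans f y \<in> X" if y: "y \<in> X" for y
    proof -
      obtain g n where g: "functional g" "n \<in> N" "y = ltrans g n"
        using X_E y by blast
      show ?thesis
        using X_I[OF functional_conv[OF g(1) f] g(2)] ltrans_ltrans[OF f g(1), of n] g(3) by simp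
    qed
    then have "span (ltrans f ` X) \<subseteq> span X"
      by (intro span_mono) auto
    then show "ltrans f x \<in> span X"
      using x l.span_image[of X] by auto
  qed
  obtain Y where "finite Y" "X \<subseteq> span Y"
    using ltrans_image_fin_dim[OF assms(2)] unfolding fin_dim_def X_def by blast
  then show "fin_dim scale (span X)"
    by (intro fin_dim_spanI[of Y] span_minimal) auto
  show "N \<subseteq> span X"
  proof
    fix n assume "n \<in> N"
    then show "n \<in> span X"
      using X_I[OF functional_counit, of n] by (simp add: ltrans_counit span_base)
  qed
qed

text \<open>Dimensions are bounded by that of C, so a candidate of largest dimension exists; {0} is
  a candidate since 1 \<noteq> 0.\<close>

lemma maximal_right_coideal_avoiding_one:
  assumes "right_coideal C" "fin_dim scale C"
  obtains W where "right_coideal W" "W \<subseteq> C" "1 \<notin> W"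
    "\<And>E. right_coideal E \<Longrightarrow> W \<subset> E \<Longrightarrow> E \<subseteq> C \<Longrightarrow> 1 \<in> E"
proof -
  define Q where "Q W \<longleftrightarrow> right_coideal W \<and> W \<subseteq> C \<and> 1 \<notin> W" for W
  have subC: "subspace C"
    using assms(1) by (simp add: right_coideal_def)
  have "(1 :: 'h) \<noteq> 0"
    using counit_one counit_linear_simps(1) by auto
  then have "Q {0}"
    using subspace_0[OF subC] by (simp add: Q_def right_coideal_def rtrans_linear_simps)
  moreover have "\<forall>W. Q W \<longrightarrow> dim W < Suc (dim C)"
    using dim_mono_fin_dim[OF assms(2) _ subC] by (simp add: Q_def right_coideal_def less_Suc_eq_le)
  ultimately have "\<exists>W. Q W \<and> (\<forall>E. Q E \<longrightarrow> dim E \<le> dim W)"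
    by (rule ex_has_greatest_nat)
  then obtain W where W: "Q W" "\<And>E. Q E \<Longrightarrow> dim E \<le> dim W"
    by blast
  have "1 \<in> E" if E: "right_coideal E" "W \<subset> E" "E \<subseteq> C" for E
  proof (rule ccontr)
    assume "1 \<notin> E"
    then have "dim E \<le> dim W"
      using E by (intro W(2)) (simp add: Q_def)
    moreover have "dim W < dim E"
      using E W(1) fin_dim_subset[OF assms(2) E(3)]
      by (intro dim_strict_mono) (auto simp: Q_def right_coideal_def)
    ultimately show False by simp
  qed
  then show ?thesis
    using that[of W] W(1) by (simp add: Q_def)
qed

lemma aug_act_eq_imp_trivial:
  assumes "right_coideal V" "fin_dim scale V" "aug_act V = V"
  shows "V = {0}"
proof (rule ccontr)
  assume "V \<noteq> {0}"
  define P where "P N \<longleftrightarrow> right_coideal N \<and> fin_dim scale N \<and> aug_act N = N \<and> N \<noteq> {0}" for N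
  have "P V"
    unfolding P_def using assms \<open>V \<noteq> {0}\<close> by blast
  then have "\<exists>N. P N \<and> (\<forall>E. P E \<longrightarrow> dim N \<le> dim E)"
    by (rule ex_has_least_nat)
  then obtain N where "P N" and least: "\<And>E. P E \<Longrightarrow> dim N \<le> dim E"
    by blast
  then have N: "right_coideal N" "subspace N" "fin_dim scale N" "aug_act N = N" "N \<noteq> {0}"
    unfolding P_def right_coideal_def by blast+
  have simple: "E = {0} \<or> E = N" if E: "right_coideal E" "E \<subseteq> N" for E
  proof (rule ccontr)
    assume *: "\<not> (E = {0} \<or> E = N)"
    then have "E \<subset> N" "E \<noteq> {0}"
      using E(2) by auto
    then obtain M where M: "right_coideal M" "fin_dim scale M" "aug_act M = M" "M \<noteq> {0}" "dim M < dim N"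
      using smaller_perfect_right_coideal[OF N(1,3,4) E(1)] by blast
    have "P M"
      unfolding P_def using M(1-4) by blast
    from least[OF this] M(5) show False by simp
  qed
  define X where "X = (\<Union>f\<in>Collect functional. ltrans f ` N)"
  note C = subcoalgebra_span_ltrans[OF N(1,3), folded X_def]
  have "span X \<noteq> {0}"
    using C(4) N(5) subspace_0[OF N(2)] by blast
  then have one: "1 \<in> span X"
    using one_mem_subcoalgebra C(1,3) by blast
  obtain W where W: "right_coideal W" "W \<subseteq> span X" "1 \<notin> W"
    and max: "\<And>E. right_coideal E \<Longrightarrow> W \<subset> E \<Longrightarrow> E \<subseteq> span X \<Longrightarrow> 1 \<in> E"
    using maximal_right_coideal_avoiding_one[OF C(2,3)] by blast
  have subW: "subspace W"
    using W(1) by (simp add: right_coideal_def)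
  have "\<not> X \<subseteq> W"
    using one W(3) span_minimal[OF _ subW, of X] by blast
  then obtain g n where g: "functional g" "n \<in> N" "ltrans g n \<notin> W"
    unfolding X_def by blast
  interpret lg: Vector_Spaces.linear scale scale "ltrans g"
    using g(1) by (rule linear_ltrans)
  \<comment> \<open>The sum of W and the translate of N is strictly larger than W, so by maximality
    it contains 1. Modulo W, the element 1 is therefore the image of some m in N.\<close>
  define W' where "W' = {w + z |w z. w \<in> W \<and> z \<in> ltrans g ` N}"
  have coN: "right_coideal (ltrans g ` N)"
    using N(1) g(1) by (rule right_coideal_ltrans_image)
  then have subN: "subspace (ltrans g ` N)"
    by (simp add: right_coideal_def)
  have subW': "subspace W'"
    unfolding W'_def using subW subN by (rule subspace_sums)
  have coW': "right_coideal W'"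
    unfolding right_coideal_def
  proof (intro conjI allI impI subW')
    fix f x assume "functional f \<and> x \<in> W'"
    then obtain w z where f: "functional f" and x: "x = w + z" "w \<in> W" "z \<in> ltrans g ` N"
      unfolding W'_def by blast
    have "rtrans f x = rtrans f w + rtrans f z"
      using x(1) f by (simp add: rtrans_linear_simps)
    moreover have "rtrans f w \<in> W" "rtrans f z \<in> ltrans g ` N"
      using f x(2,3) W(1) coN unfolding right_coideal_def by blast+
    ultimately show "rtrans f x \<in> W'"
      unfolding W'_def by blast
  qed
  have "W \<subseteq> W'"
    using subspace_0[OF subN] by (force simp: W'_def)
  moreover have "ltrans g n \<in> W'"
    using g(2) subspace_0[OF subW] by (force simp: W'_def)
  moreover have "W' \<subseteq> span X"
  proof -
    have "ltrans g ` N \<subseteq> span X"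
      using g(1) span_superset[of X] by (auto simp: X_def)
    then show ?thesis
      using W(2) by (auto simp: W'_def intro!: span_add)
  qed
  ultimately have "1 \<in> W'"
    using g(3) by (intro max coW') auto
  then obtain w m where m: "1 = w + ltrans g m" "w \<in> W" "m \<in> N"
    unfolding W'_def by blast
  \<comment> \<open>The kernel of the map from N to the quotient by W. It is a proper subcoideal of
    the simple N, so the map is injective.\<close>
  define M where "M = {y \<in> N. ltrans g y \<in> W}"
  have "right_coideal M"
    unfolding right_coideal_def
  proof (intro conjI allI impI)
    show "subspace M"
      unfolding M_def using N(2) subW
      by (auto simp: lg.add lg.scale subspace_0 subspace_add subspace_scale intro!: subspaceI)
    fix f y assume "functional f \<and> y \<in> M"
    then show "rtrans f y \<in> M"
      using N(1) W(1) rtrans_ltrans[OF g(1), of f y]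
      unfolding M_def right_coideal_def by (metis (mono_tags, lifting) mem_Collect_eq)
  qed
  moreover have "n \<notin> M" "M \<subseteq> N"
    using g(3) by (auto simp: M_def)
  ultimately have "M = {0}"
    using simple g(2) by blast
  \<comment> \<open>Translating 1 = w + ltrans g m by f in \<open>aug_dual\<close> annihilates the
    left side, so the image of \<open>rtrans f m\<close> is zero modulo W.\<close>
  have kill: "rtrans f m = 0" if f: "f \<in> aug_dual" for f
  proof -
    note f' = aug_dual_functional[OF f]
    have "rtrans f 1 = 0"
      using f rtrans_one[OF f'] by (simp add: aug_dual_def)
    then have "rtrans f w + ltrans g (rtrans f m) = 0"
      using m(1) rtrans_linear_simps(2)[OF f', of w "ltrans g m"] rtrans_ltrans[OF g(1) f', of m]
      by simp
    then have "ltrans g (rtrans f m) = - rtrans f w"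
      by (simp add: eq_neg_iff_add_eq_0 add.commute)
    then have "ltrans g (rtrans f m) \<in> W"
      using m(2) f' W(1) subW by (simp add: right_coideal_def subspace_neg)
    moreover have "rtrans f m \<in> N"
      using m(3) f' N(1) by (simp add: right_coideal_def)
    ultimately have "rtrans f m \<in> M"
      by (simp add: M_def)
    then show ?thesis
      using \<open>M = {0}\<close> by simp
  qed
  \<comment> \<open>The part of N on which \<open>aug_dual\<close> acts as zero. It contains m
    \<noteq> 0, hence is all of N, which contradicts aug_act N = N \<noteq> {0}.\<close>
  define K where "K = {y \<in> N. \<forall>f\<in>aug_dual. rtrans f y = 0}"
  have "right_coideal K"
    unfolding right_coideal_def
  proof (intro conjI allI impI)
    show "subspace K"
      using N(2)
      by (auto simp: K_def rtrans_linear_simps aug_dual_functional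
          subspace_0 subspace_add subspace_scale intro!: subspaceI)
    fix f x assume *: "functional f \<and> x \<in> K"
    have "rtrans h (rtrans f x) = 0" if "h \<in> aug_dual" for h
      using * that conv_aug_dual_left[of h f] by (simp add: K_def rtrans_rtrans aug_dual_functional)
    then show "rtrans f x \<in> K"
      using * N(1) by (simp add: K_def right_coideal_def)
  qed
  moreover have "m \<in> K"
    using m(3) kill by (simp add: K_def)
  moreover have "m \<noteq> 0"
    using m(1,2) W(3) by auto
  moreover have "K \<subseteq> N"
    by (auto simp: K_def)
  ultimately have "K = N"
    using simple[of K] by blast
  then have "aug_act N \<subseteq> span {0}"
    unfolding aug_act_def by (intro span_mono) (auto simp: K_def)
  then show False
    using N(4,5) subspace_0[OF N(2)] by auto
qed

text \<open>Every element lies in a finite-dimensional right coideal V. By Nakayama's lemma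
  \<open>aug_act V\<close> is smaller unless V is zero, and one filtration step leads from
  \<open>aug_act V\<close> back to V.\<close>

lemma filt_exhaustive: "\<exists>n. x \<in> filt n"
proof -
  have "\<exists>n. V \<subseteq> filt n" if "right_coideal V" "fin_dim scale V" for V
    using that
  proof (induction "dim V" arbitrary: V rule: less_induct)
    case less
    show ?case
    proof (cases "aug_act V = V")
      case True
      then have "V \<subseteq> filt 0"
        using aug_act_eq_imp_trivial[OF less.prems] by simp
      then show ?thesis by blast
    next
      case False
      have sub: "aug_act V \<subseteq> V"
        using aug_act_subset less.prems(1) .
      have co: "right_coideal (aug_act V)"
        using right_coideal_aug_act less.prems(1) .
      have "dim (aug_act V) < dim V"
        using False sub co less.prems by (intro dim_strict_mono) (auto simp: right_coideal_def)
      then obtain n where n: "aug_act V \<subseteq> filt n"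
        using less.hyps[of "aug_act V"] co fin_dim_subset[OF less.prems(2) sub] by blast
      have "rtrans f v \<in> filt n" if "f \<in> aug_dual" "v \<in> V" for f v
        using that n span_superset by (fastforce simp: aug_act_def)
      then have "V \<subseteq> filt (Suc n)"
        by auto
      then show ?thesis by blast
    qed
  qed
  moreover obtain W where "right_coideal W" "fin_dim scale W" "x \<in> W"
    by (rule fin_dim_right_coideal_exists)
  ultimately show ?thesis
    by blast
qed

text \<open>Testing with a bilinear map and a subspace X takes the place of membership in a sum of
  tensor products. The term with \<epsilon> x corrects for the scalar part of x, which x \<otimes> 1
  and 1 \<otimes> x both contain.\<close>

lemma comult_filtered:
  assumes \<beta>: "bilin s \<beta>" and X: "module.subspace s X" and x: "x \<in> filt (Suc d)"
    and mem: "\<And>p q y z. 1 \<le> p \<Longrightarrow> 1 \<le> q \<Longrightarrow> p + q \<le> d \<Longrightarrow> y \<in> aug_filt p \<Longrightarrow> z \<in> aug_filt q \<Longrightarrow> \<beta> y z \<in> X"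
  shows "sweedler s \<beta> x - \<beta> x 1 - \<beta> 1 x + s (\<epsilon> x) (\<beta> 1 1) \<in> X"
proof -
  interpret s: vector_space s using \<beta> by (rule bilin_target)
  have \<beta>_add: "\<beta> (u + u') v = \<beta> u v + \<beta> u' v" "\<beta> u (v + v') = \<beta> u v + \<beta> u v'"
    and \<beta>_scale: "\<beta> (scale c u) v = s c (\<beta> u v)" "\<beta> u (scale c v) = s c (\<beta> u v)" for u u' v v' c
    using \<beta> unfolding bilin_iff by simp_all
  have \<beta>_diff: "\<beta> (u - u') v = \<beta> u v - \<beta> u' v" "\<beta> u (v - v') = \<beta> u v - \<beta> u v'" for u u' v v'
    using \<beta>_add(1)[of "u - u'" u' v] \<beta>_add(2)[of u "v - v'" v'] by (simp_all add: algebra_simps)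
  have \<beta>_lin: "Vector_Spaces.linear scale s (\<lambda>u. \<beta> u v)" "Vector_Spaces.linear scale s (\<beta> u)" for u v
    using \<beta> unfolding bilin_def by simp_all
  obtain B where B: "\<And>n. B n \<subseteq> B (Suc n)" "\<And>n. independent (B n)"
    "\<And>n. B n \<subseteq> aug_filt n" "\<And>n. aug_filt n \<subseteq> span (B n)"
    using adapted_basis by blast
  define U where "U = (\<Union>n. B n)"
  have B_mono: "B m \<subseteq> B n" if "m \<le> n" for m n
    using lift_Suc_mono_le[of B, OF B(1)] that .
  have indU: "independent U"
    unfolding U_def
  proof (rule independent_Union_directed)
    show "c \<subseteq> d \<or> d \<subseteq> c" if "c \<in> range B" "d \<in> range B" for c d
      using that B_mono nat_le_linear by (metis rangeE)
  qed (use B(2) in auto)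
  \<comment> \<open>The projection to the kernel of \<epsilon> along 1. Applied to both legs it
    leaves exactly the middle terms of \<Delta> x.\<close>
  define bar where "bar a = a - scale (\<epsilon> a) 1" for a
  have bar_lin: "bar (a + b) = bar a + bar b" "bar (scale c a) = scale c (bar a)" for a b c
    unfolding bar_def by (simp_all add: counit_linear_simps scale_left_distrib scale_right_diff_distrib)
  have bar_filt: "bar a \<in> aug_filt n" if "a \<in> filt (Suc n)" for a n
    using sub_counit_aug_filt[OF that] by (simp only: bar_def)
  have bar_span: "bar a \<in> span U" for a
  proof -
    obtain n where "a \<in> filt n"
      using filt_exhaustive by blast
    then have "bar a \<in> aug_filt n"
      using bar_filt filt_Suc_mono by blast
    moreover have "span (B n) \<subseteq> span U"
      by (rule span_mono) (auto simp: U_def)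
    ultimately show ?thesis
      using B(4) by blast
  qed
  define r where "r u a = representation U (bar a) u" for u a
  have r_lin: "functional (r u)" for u
    unfolding functional_iff r_def bar_lin
    by (simp add: representation_add[OF indU bar_span bar_span] representation_scale[OF indU bar_span])
  define D where "D u = (LEAST n. u \<in> B n)" for u
  have D: "u \<in> B (D u)" "1 \<le> D u" "u \<in> aug_filt (D u)" if "u \<in> U" for u
  proof -
    show *: "u \<in> B (D u)"
      using that unfolding D_def U_def by (auto intro: LeastI)
    then show "u \<in> aug_filt (D u)"
      using B(3) by blast
    have "u \<noteq> 0"
      using * B(2)[of "D u"] dependent_zero by blast
    then show "1 \<le> D u"
      using B(3)[of 0] * aug_filt_0 by (cases "D u") auto
  qed
  \<comment> \<open>As u first occurs in \<open>B (D u)\<close>, the elements of smaller degree are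
    expanded in a basis without u; \<open>filt (D u)\<close> holds the degrees up to D u -
    1.\<close>
  have r_vanish: "r u y = 0" if u: "u \<in> U" and y: "y \<in> filt (D u)" for u y
  proof -
    obtain m where m: "D u = Suc m"
      using D(2)[OF u] by (cases "D u") auto
    have *: "bar y \<in> span (B m)"
      using bar_filt[of y m] y B(4)[of m] unfolding m by blast
    have "r u y = representation (B m) (bar y) u"
      unfolding r_def using * indU by (subst representation_extend[of U _ "B m"]) (auto simp: U_def)
    moreover have "u \<notin> B m"
      using not_less_Least[of m "\<lambda>n. u \<in> B n"] m by (simp add: D_def)
    ultimately show ?thesis
      using representation_ne_zero[of "B m" "bar y" u] by auto
  qed
  define V where "V = (\<Union>(a, b)\<in>Poly_Mapping.keys (\<Delta> x). {u. r u a \<noteq> 0} \<union> {u. r u b \<noteq> 0})"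
  have finV: "finite V"
    unfolding V_def r_def by (auto intro!: finite_representation)
  have VU: "V \<subseteq> U"
    unfolding V_def r_def by (auto dest: representation_ne_zero)
  have expand: "(\<Sum>u\<in>V. scale (r u a) u) = bar a" if "\<And>u. r u a \<noteq> 0 \<Longrightarrow> u \<in> V" for a
  proof -
    have "(\<Sum>u\<in>V. scale (r u a) u) = (\<Sum>u | representation U (bar a) u \<noteq> 0. scale (r u a) u)"
      using finV that by (intro sum.mono_neutral_right) (auto simp: r_def)
    then show ?thesis
      using sum_nonzero_representation_eq[OF indU bar_span[of a]] by (simp add: r_def)
  qed
  have "sweedler s (\<lambda>a b. \<beta> (bar a) (bar b)) x =
      sweedler s (\<lambda>a b. \<Sum>u\<in>V. \<Sum>v\<in>V. s (r u a * r v b) (\<beta> u v)) x"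
  proof (rule sweedler_cong)
    fix a b assume ab: "(a, b) \<in> Poly_Mapping.keys (\<Delta> x)"
    have "u \<in> V" if "r u a \<noteq> 0 \<or> r u b \<noteq> 0" for u
      using that ab unfolding V_def by blast
    then have ea: "bar a = (\<Sum>u\<in>V. scale (r u a) u)" and eb: "bar b = (\<Sum>u\<in>V. scale (r u b) u)"
      using expand[of a] expand[of b] by simp_all
    have "\<beta> (bar a) (bar b) = (\<Sum>u\<in>V. s (r u a) (\<beta> u (bar b)))"
      unfolding ea by (simp add: linear_map_sum[OF \<beta>_lin(1)] \<beta>_scale)
    also have "\<dots> = (\<Sum>u\<in>V. \<Sum>v\<in>V. s (r u a * r v b) (\<beta> u v))"
      unfolding eb by (simp add: linear_map_sum[OF \<beta>_lin(2)] \<beta>_scale s.scale_sum_right)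
    finally show "\<beta> (bar a) (bar b) = (\<Sum>u\<in>V. \<Sum>v\<in>V. s (r u a * r v b) (\<beta> u v))" .
  qed
  also have "\<dots> = (\<Sum>u\<in>V. \<Sum>v\<in>V. s (conv (r u) (r v) x) (\<beta> u v))"
    by (simp add: sweedler_sum[OF s.vector_space_axioms] sweedler_scale_left[OF s.vector_space_axioms] conv_def)
  also have "\<dots> \<in> X"
  proof (intro s.subspace_sum X)
    fix u v assume "u \<in> V" "v \<in> V"
    then have uv: "u \<in> U" "v \<in> U"
      using VU by auto
    show "s (conv (r u) (r v) x) (\<beta> u v) \<in> X"
    proof (cases "D u + D v \<le> d")
      case True
      then show ?thesis
        using D uv by (intro s.subspace_scale X mem[of "D u" "D v"])
    next
      case False
      \<comment> \<open>Now d < D u + D v, so the coefficient of u \<otimes> v is a convolution of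
        functionals that vanish on too many layers.\<close>
      then have "conv (r u) (r v) x = 0"
        using x r_vanish uv by (intro conv_eq_0_on_filt[of _ "D u" _ "D v" "Suc d"] r_lin) auto
      then show ?thesis
        using s.subspace_0[OF X] by simp
    qed
  qed
  finally have main: "sweedler s (\<lambda>a b. \<beta> (bar a) (bar b)) x \<in> X" .
  have "sweedler s (\<lambda>a b. \<beta> (bar a) (bar b)) x = sweedler s (\<lambda>a b. \<beta> a b - s (\<epsilon> b) (\<beta> a 1)
      - s (\<epsilon> a) (\<beta> 1 b) + s (\<epsilon> a * \<epsilon> b) (\<beta> 1 1)) x"
    unfolding bar_def by (intro sweedler_cong) (simp add: \<beta>_diff \<beta>_scale algebra_simps s.scale_right_diff_distrib mult.commute)
  also have "\<dots> = sweedler s \<beta> x - \<beta> x 1 - \<beta> 1 x + s (conv \<epsilon> \<epsilon> x) (\<beta> 1 1)"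
    unfolding sweedler_add[OF s.vector_space_axioms] sweedler_diff[OF s.vector_space_axioms]
      sweedler_scale_left[OF s.vector_space_axioms] conv_def
    by (simp only: sweedler_counit_left[OF \<beta>_lin(2)] sweedler_counit_right[OF \<beta>_lin(1)])
  also have "conv \<epsilon> \<epsilon> x = \<epsilon> x"
    using functional_rtrans[OF functional_counit, of \<epsilon> x] by (simp add: rtrans_counit)
  finally show ?thesis
    using main by simp
qed

section \<open>Products and commutators in the filtration\<close>

lemma rtrans_mult:
  assumes "functional f"
  shows "rtrans f (x * y) = sweedler scale (\<lambda>c d. rtrans (\<lambda>a. f (a * d)) x * c) y"
proof -
  have f: "f (a + b) = f a + f b" "f (scale k a) = k * f a" for a b k
    using assms by (simp_all add: functional_linear_simps)
  have "bilin scale (\<lambda>a b. scale (f b) a)"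
    by (simp add: bilin_iff f vector_space_axioms algebra_simps)
  from free_extend_tensor2_eq[OF comult_mult[of x y] this]
  have "rtrans f (x * y) = sweedler scale (\<lambda>a b. sweedler scale (\<lambda>c d. scale (f (b * d)) (a * c)) y) x"
    unfolding rtrans_def sweedler_def tensor2_mult_def
    by (simp add: case_prod_unfold free_extend_free_extend[OF vector_space_axioms])
  also have "\<dots> = sweedler scale (\<lambda>c d. sweedler scale (\<lambda>a b. scale (f (b * d)) (a * c)) x) y"
    by (rule sweedler_swap[OF vector_space_axioms])
  also have "\<dots> = sweedler scale (\<lambda>c d. rtrans (\<lambda>a. f (a * d)) x * c) y"
  proof (rule sweedler_cong)
    fix c d
    have lin: "Vector_Spaces.linear scale scale (\<lambda>z. z * c)"
      by (simp add: linear_endo_iff algebra_simps scale_mult_left)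
    show "sweedler scale (\<lambda>a b. scale (f (b * d)) (a * c)) x = rtrans (\<lambda>a. f (a * d)) x * c"
      unfolding rtrans_def linear_image_sweedler[OF lin] by (simp add: scale_mult_left)
  qed
  finally show ?thesis .
qed

text \<open>Translation by \<open>f \<in> aug_dual\<close> is a derivation of the associated graded algebra.\<close>

lemma rtrans_mult_derivation:
  assumes f: "f \<in> aug_dual" and x: "x \<in> filt (Suc i)" and y: "y \<in> filt (Suc j)"
    and IH: "\<And>p u v. p < j \<Longrightarrow> u \<in> filt i \<Longrightarrow> v \<in> filt (Suc p) \<Longrightarrow> u * v \<in> filt (i + p)"
  shows "rtrans f (x * y) - rtrans f x * y - x * rtrans f y \<in> filt (i + j - 1)"
proof (cases j)
  case 0
  have "y = scale (\<epsilon> y) 1"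
    using y 0 by (intro filt_1) simp
  then obtain c where c: "y = scale c 1" ..
  have "rtrans f y = 0"
    using f unfolding c
    by (simp add: rtrans_linear_simps[OF aug_dual_functional] rtrans_one[OF aug_dual_functional])
      (simp add: aug_dual_def)
  moreover have "rtrans f (x * y) = rtrans f x * y"
    unfolding c using f by (simp add: scale_mult_right rtrans_linear_simps[OF aug_dual_functional])
  ultimately show ?thesis
    using subspace_0[OF filt_subspace] by simp
next
  case (Suc j')
  let ?X = "filt (i + j - 1)"
  have f': "functional f" "f 1 = 0"
    using f by (auto simp: aug_dual_def)
  have f_lin: "f (a + b) = f a + f b" "f (scale k a) = k * f a" for a b k
    using f' by (simp_all add: functional_linear_simps)
  \<comment> \<open>The functional f(_ * v) has the value f v at 1, so \<open>e v\<close> is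
    translation of x by its component in \<open>aug_dual\<close> and therefore loses one
    degree.\<close>
  define e where "e v = rtrans (\<lambda>a. f (a * v)) x - scale (f v) x" for v
  have fv: "functional (\<lambda>a. f (a * v))" for v
    by (simp add: functional_iff f_lin distrib_right scale_mult_left)
  have e: "e v \<in> filt i" for v
  proof -
    have "e v = rtrans (\<lambda>a. f (a * v) - f v * \<epsilon> a) x"
      by (simp only: rtrans_sub_counit e_def)
    moreover have "(\<lambda>a. f (a * v) - f v * \<epsilon> a) \<in> aug_dual"
      using functional_sub_counit_aug_dual[OF fv[of v]] by simp
    ultimately show ?thesis
      using x by simp
  qed
  have rt_lin: "rtrans (\<lambda>a. f (a * (v + w))) x = rtrans (\<lambda>a. f (a * v)) x + rtrans (\<lambda>a. f (a * w)) x"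
      "rtrans (\<lambda>a. f (a * scale c v)) x = scale c (rtrans (\<lambda>a. f (a * v)) x)" for v w c
    unfolding rtrans_def sweedler_add[OF vector_space_axioms, symmetric]
      sweedler_scale[OF vector_space_axioms, symmetric]
    by (simp_all add: distrib_left f_lin scale_left_distrib scale_mult_right)
  have "bilin scale (\<lambda>u v. e v * u)"
    unfolding bilin_iff e_def rt_lin f_lin
    by (simp add: vector_space_axioms algebra_simps scale_mult_left scale_mult_right scale_right_diff_distrib)
  \<comment> \<open>In \<Delta> y the term y \<otimes> 1 gives \<open>rtrans f x * y\<close>. The
    term 1 \<otimes> y gives \<open>e y\<close>, which is negligible because j > 0, and the middle
    terms are negligible by \<open>IH\<close>.\<close>
  then have "sweedler scale (\<lambda>u v. e v * u) y - e 1 * y - e y * 1 + scale (\<epsilon> y) (e 1 * 1) \<in> ?X"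
    using filt_subspace y
  proof (rule comult_filtered)
    fix p q u v assume "1 \<le> q" "p + q \<le> j" "u \<in> aug_filt p"
    then have "p < j" "u \<in> filt (Suc p)"
      using aug_filt_subset by auto
    then have "e v * u \<in> filt (i + p)"
      using IH e by blast
    moreover have "filt (i + p) \<subseteq> ?X"
      using \<open>p < j\<close> by (intro filt_mono) auto
    ultimately show "e v * u \<in> ?X"
      by blast
  qed
  moreover have "sweedler scale (\<lambda>u v. e v * u) y = rtrans f (x * y) - x * rtrans f y"
  proof -
    have lin: "Vector_Spaces.linear scale scale ((*) x)"
      by (simp add: linear_endo_iff algebra_simps scale_mult_right)
    have "sweedler scale (\<lambda>u v. e v * u) y =
        sweedler scale (\<lambda>u v. rtrans (\<lambda>a. f (a * v)) x * u - x * scale (f v) u) y"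
      by (simp add: e_def left_diff_distrib scale_mult_left scale_mult_right)
    also have "\<dots> = rtrans f (x * y) - sweedler scale (\<lambda>u v. x * scale (f v) u) y"
      unfolding sweedler_diff[OF vector_space_axioms] rtrans_mult[OF f'(1)] ..
    also have "sweedler scale (\<lambda>u v. x * scale (f v) u) y = x * rtrans f y"
      unfolding rtrans_def linear_image_sweedler[OF lin] ..
    finally show ?thesis .
  qed
  moreover have e1: "e 1 = rtrans f x"
    by (simp add: e_def f'(2))
  ultimately have main: "rtrans f (x * y) - x * rtrans f y - rtrans f x * y - e y + scale (\<epsilon> y) (e 1) \<in> ?X"
    by simp
  have eX: "e v \<in> ?X" for v
    using e filt_mono[of i "i + j - 1"] Suc by auto
  show ?thesis
    using subspace_diff[OF filt_subspace subspace_add[OF filt_subspace main eX]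
        subspace_scale[OF filt_subspace eX], of y "\<epsilon> y" 1]
    by (simp add: algebra_simps)
qed

text \<open>Membership is tested by translations. By the derivation rule the translate of x y
  consists of \<open>rtrans f x * y\<close>, \<open>x * rtrans f y\<close> and a smaller error, so
  induction on i + j applies.\<close>

lemma filt_mult: "x \<in> filt (Suc i) \<Longrightarrow> y \<in> filt (Suc j) \<Longrightarrow> x * y \<in> filt (Suc (i + j))"
proof (induction "i + j" arbitrary: i j x y rule: less_induct)
  case less
  \<comment> \<open>The induction hypothesis for the unshifted index i'; at i' = 0 the first factor
    is zero.\<close>
  have prod: "u * v \<in> filt (i' + p)" if "u \<in> filt i'" "v \<in> filt (Suc p)" "i' + p \<le> i + j" for i' p u v
  proof (cases i')
    case 0
    then show ?thesis
      using that(1) subspace_0[OF filt_subspace] by simp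
  next
    case (Suc k)
    then show ?thesis
      using less.hyps[of k p u v] that by simp
  qed
  have "rtrans f (x * y) \<in> filt (i + j)" if f: "f \<in> aug_dual" for f
  proof -
    have d: "rtrans f (x * y) - rtrans f x * y - x * rtrans f y \<in> filt (i + j - 1)"
      using f less.prems by (rule rtrans_mult_derivation) (rule prod; simp)
    have 1: "rtrans f x * y \<in> filt (i + j)"
      using f less.prems by (intro prod) auto
    have 2: "x * rtrans f y \<in> filt (i + j)"
    proof (cases j)
      case 0
      then show ?thesis
        using f less.prems subspace_0[OF filt_subspace] by simp
    next
      case (Suc k)
      then have "rtrans f y \<in> filt (Suc k)"
        using f less.prems(2) by simp
      then show ?thesis
        using less.hyps[of i k x] less.prems(1) Suc by simp
    qed
    have "(rtrans f (x * y) - rtrans f x * y - x * rtrans f y) + rtrans f x * y + x * rtrans f y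
        \<in> filt (i + j)"
      using d 1 2 filt_mono[of "i + j - 1" "i + j"]
      by (intro subspace_add[OF filt_subspace]) auto
    then show ?thesis by simp
  qed
  then show ?case by simp
qed

text \<open>Up to smaller terms, translation sends [x, y] to [rtrans f x, y] + [x, rtrans f y], to
  which induction applies. Because of the shift, \<open>filt (i + j)\<close> is one degree below the
  product.\<close>

lemma filt_commutator:
  "x \<in> filt (Suc i) \<Longrightarrow> y \<in> filt (Suc j) \<Longrightarrow> x * y - y * x \<in> filt (i + j)"
proof (induction "i + j" arbitrary: i j x y rule: less_induct)
  case less
  show ?case
  proof (cases "i = 0 \<or> j = 0")
    case True
    then have "x = scale (\<epsilon> x) 1 \<or> y = scale (\<epsilon> y) 1"
      using less.prems filt_1 by blast
    then have "x * y = y * x"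
      by (metis scale_mult_left scale_mult_right mult_1_left mult_1_right)
    then show ?thesis
      using subspace_0[OF filt_subspace] by simp
  next
    case False
    then obtain k l where kl: "i = Suc k" "j = Suc l"
      by (meson not0_implies_Suc)
    have "rtrans f (x * y - y * x) \<in> filt (i + j - 1)" if f: "f \<in> aug_dual" for f
    proof -
      have prod: "u * v \<in> filt (Suc m + p)" if "u \<in> filt (Suc m)" "v \<in> filt (Suc p)" for u v m p
        using filt_mult[OF that] by simp
      have 1: "rtrans f (x * y) - rtrans f x * y - x * rtrans f y \<in> filt (i + j - 1)"
        using f less.prems by (rule rtrans_mult_derivation) (use prod kl in blast)
      have 2: "rtrans f (y * x) - rtrans f y * x - y * rtrans f x \<in> filt (i + j - 1)"
        using f less.prems(2,1) unfolding add.commute[of i j]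
        by (rule rtrans_mult_derivation) (use prod kl in blast)
      have "rtrans f x \<in> filt (Suc k)" "rtrans f y \<in> filt (Suc l)"
        using f less.prems kl by simp_all
      then have 3: "rtrans f x * y - y * rtrans f x \<in> filt (i + j - 1)"
        and 4: "x * rtrans f y - rtrans f y * x \<in> filt (i + j - 1)"
        using less.hyps[of k j "rtrans f x" y] less.hyps[of i l x "rtrans f y"] less.prems kl
        by simp_all
      have "(rtrans f (x * y) - rtrans f x * y - x * rtrans f y)
          - (rtrans f (y * x) - rtrans f y * x - y * rtrans f x)
          + (rtrans f x * y - y * rtrans f x) + (x * rtrans f y - rtrans f y * x) \<in> filt (i + j - 1)"
        by (intro subspace_add[OF filt_subspace] subspace_diff[OF filt_subspace] 1 2 3 4)
      then show ?thesis
        using f by (simp add: rtrans_linear_simps aug_dual_functional algebra_simps)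
    qed
    then have "x * y - y * x \<in> filt (Suc (i + j - 1))"
      by simp
    then show ?thesis
      using kl by simp
  qed
qed

lemma filt_mult_left:
  assumes "x \<in> filt i" "y \<in> filt (Suc j)"
  shows "x * y \<in> filt (i + j)"
  using filt_mult[of x "i - 1" y j] assms subspace_0[OF filt_subspace] by (cases i) auto

lemma filt_mult_right:
  assumes "x \<in> filt (Suc i)" "y \<in> filt j"
  shows "x * y \<in> filt (i + j)"
  using filt_mult[of x i y "j - 1"] assms subspace_0[OF filt_subspace] by (cases j) auto

end

section \<open>Leading terms of the action\<close>

lemma indices_exist:
  assumes "set ys \<subseteq> set zs"
  shows "\<exists>u. set u \<subseteq> {..<length zs} \<and> map ((!) zs) u = ys"
  using assms
proof (induction ys)
  case (Cons y ys)
  then obtain u i where "set u \<subseteq> {..<length zs}" "map ((!) zs) u = ys" "i < length zs" "zs ! i = y"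
    by (auto simp: in_set_conv_nth)
  then show ?case
    by (intro exI[of _ "i # u"]) auto
qed simp

text \<open>The unshuffles of a word, as in the coproduct of a product of primitive elements.
  Repeated pairs are kept, since their number becomes an integer coefficient.\<close>

primrec splits :: "'b list \<Rightarrow> ('b list \<times> 'b list) list"
  where
    "splits [] = [([], [])]"
  | "splits (z # zs) = map (\<lambda>(u, v). (z # u, v)) (splits zs) @ map (\<lambda>(u, v). (u, z # v)) (splits zs)"

lemma splits_mset: "(u, v) \<in> set (splits zs) \<Longrightarrow> mset u + mset v = mset zs"
  by (induction zs arbitrary: u v) auto

lemma splits_append: "(u, v) \<in> set (splits (u @ v))"
proof (induction u)
  case Nil
  then show ?case by (induction v) force+
qed force

lemma splits_map: "splits (map f zs) = map (map_prod (map f) (map f)) (splits zs)"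
  by (induction zs) (simp_all add: case_prod_unfold)

text \<open>Each letter carries its degree as a label, because an element of one
  \<open>aug_filt\<close> also lies in all later ones.\<close>

definition wdeg :: "('b \<times> nat) list \<Rightarrow> nat"
  where "wdeg w = sum_list (map snd w)"

definition wval :: "('h::monoid_mult \<times> 'd) list \<Rightarrow> 'h"
  where "wval w = prod_list (map fst w)"

lemma wdeg_simps [simp]: "wdeg [] = 0" "wdeg (z # w) = snd z + wdeg w" "wdeg (u @ v) = wdeg u + wdeg v"
  by (simp_all add: wdeg_def)

lemma wval_simps [simp]: "wval [] = 1" "wval (z # w) = fst z * wval w" "wval (u @ v) = wval u * wval v"
  by (simp_all add: wval_def)

lemma wdeg_mset: "wdeg w = sum_mset (image_mset snd (mset w))"
  unfolding wdeg_def by (metis mset_map sum_mset_sum_list)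

lemma splits_facts:
  assumes "(u, v) \<in> set (splits zs)"
  shows "set u \<subseteq> set zs" "set v \<subseteq> set zs" "length u + length v = length zs"
  using splits_mset[OF assms] by (metis set_mset_mset set_mset_union sup_ge1 sup_ge2 size_mset size_union)+

lemma splits_wdeg: "(u, v) \<in> set (splits zs) \<Longrightarrow> wdeg u + wdeg v = wdeg zs"
  using splits_mset[of u v zs] by (metis wdeg_mset image_mset_union sum_mset.union)

context connected_hopf_algebra
begin

definition valid_word :: "('h \<times> nat) list \<Rightarrow> bool"
  where "valid_word w \<longleftrightarrow> (\<forall>(x, d)\<in>set w. 1 \<le> d \<and> x \<in> aug_filt d)"

lemma valid_word_simps [simp]:
  "valid_word []" "valid_word (z # w) \<longleftrightarrow> 1 \<le> snd z \<and> fst z \<in> aug_filt (snd z) \<and> valid_word w"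
  "valid_word (u @ v) \<longleftrightarrow> valid_word u \<and> valid_word v"
  by (auto simp: valid_word_def)

lemma valid_word_subset: "valid_word w \<Longrightarrow> set u \<subseteq> set w \<Longrightarrow> valid_word u"
  by (auto simp: valid_word_def)

lemma length_le_wdeg: "valid_word w \<Longrightarrow> length w \<le> wdeg w"
  by (induction w) auto

lemma wval_filt: "valid_word w \<Longrightarrow> wval w \<in> filt (Suc (wdeg w))"
proof (induction w)
  case Nil
  then show ?case using one_mem_filt[of 0] by (simp del: filt.simps)
next
  case (Cons z w)
  then show ?case
    using filt_mult[of "fst z" "snd z" "wval w" "wdeg w"] aug_filt_subset by (auto simp del: filt.simps)
qed

text \<open>Bringing the first letter of u to the front of v costs a commutator, which lies one
  degree lower; the rest is induction.\<close>

lemma wval_mset_cong: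
  assumes "valid_word u" "mset u = mset v"
  shows "wval u - wval v \<in> filt (wdeg u)"
  using assms
proof (induction u arbitrary: v)
  case Nil
  then show ?case by simp
next
  case (Cons z u)
  have "z \<in> set v"
    using Cons.prems(2) by (metis list.set_intros(1) set_mset_mset)
  then obtain p q where v: "v = p @ z # q"
    by (meson split_list)
  then have m: "mset u = mset (p @ q)"
    using Cons.prems(2) by simp
  then have "set u = set p \<union> set q"
    by (metis set_append set_mset_mset)
  then have valid: "valid_word u" "valid_word p" "valid_word q"
    using Cons.prems(1) valid_word_subset by auto
  have deg: "wdeg u = wdeg p + wdeg q"
    using m by (simp add: wdeg_mset)
  let ?x = "fst z" and ?d = "snd z"
  have x: "?x \<in> filt (Suc ?d)"
    using Cons.prems(1) aug_filt_subset by auto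
  have "?x * (wval u - wval (p @ q)) \<in> filt (?d + wdeg u)"
    using Cons.IH[OF valid(1) m] x by (intro filt_mult_right)
  moreover have "(?x * wval p - wval p * ?x) * wval q \<in> filt (?d + wdeg p + wdeg q)"
    using x valid by (intro filt_mult_left filt_commutator wval_filt)
  ultimately have "?x * (wval u - wval (p @ q)) + (?x * wval p - wval p * ?x) * wval q \<in> filt (wdeg (z # u))"
    by (intro subspace_add[OF filt_subspace]) (simp_all add: deg add.assoc)
  then show ?case
    by (simp add: v algebra_simps)
qed

end

section \<open>The action modulo the ideal\<close>

locale connected_module_algebra =
  H: connected_hopf_algebra scaleH \<Delta> \<epsilon> S + module_algebra scaleH \<Delta> \<epsilon> S scaleA act
  for scaleH :: "'k::field_char_0 \<Rightarrow> 'h::{ring, monoid_mult} \<Rightarrow> 'h"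
    and \<Delta> :: "'h \<Rightarrow> ('h \<times> 'h \<Rightarrow>\<^sub>0 'k)"
    and \<epsilon> :: "'h \<Rightarrow> 'k"
    and S :: "'h \<Rightarrow> 'h"
    and scaleA :: "'k \<Rightarrow> 'a::{ring, monoid_mult} \<Rightarrow> 'a"
    and act :: "'h \<Rightarrow> 'a \<Rightarrow> 'a" +
  fixes I :: "'a set"
  assumes ideal_I: "ideal I ring_of_type"
begin

lemma act_simps:
  "act (g + h) a = act g a + act h a" "act (g - h) a = act g a - act h a" "act 0 a = 0"
  "act (scaleH c h) a = scaleA c (act h a)"
  "act h (a + b) = act h a + act h b" "act h (a - b) = act h a - act h b" "act h 0 = 0"
  "act h (scaleA c a) = scaleA c (act h a)"
  using linear_map_add[OF act_linear_left] linear_map_diff[OF act_linear_left]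
    linear_map_0[OF act_linear_left] linear_map_scale[OF act_linear_left]
    linear_map_add[OF act_linear_right] linear_map_diff[OF act_linear_right]
    linear_map_0[OF act_linear_right] linear_map_scale[OF act_linear_right]
  by auto

lemma act_mult_sweedler: "act h (a * b) = H.sweedler scaleA (\<lambda>u v. act u a * act v b) h"
  by (simp add: act_mult H.sweedler_def)

lemma bilin_act: "H.bilin scaleA (\<lambda>u v. act u a * act v b)"
  unfolding H.bilin_iff
  by (simp add: A.vector_space_axioms act_simps algebra_simps A.scale_mult_left A.scale_mult_right)

lemma subspace_I: "A.subspace I"
  and I_mult: "a \<in> I \<Longrightarrow> b * a \<in> I" "a \<in> I \<Longrightarrow> a * b \<in> I"
proof -
  interpret I: ideal I "ring_of_type :: 'a ring" by (rule ideal_I)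
  show l: "b * a \<in> I" and "a * b \<in> I" if "a \<in> I" for a b
    using I.I_l_closed[OF that, of b] I.I_r_closed[OF that, of b] by (simp_all add: ring_of_type_def)
  have "scaleA c x \<in> I" if "x \<in> I" for c x
    using l[OF that, of "scaleA c 1"] by (simp add: A.scale_mult_left)
  then show "A.subspace I"
    using additive_subgroup.a_closed[OF I.additive_subgroup_axioms]
      additive_subgroup.zero_closed[OF I.additive_subgroup_axioms]
    by (intro A.subspaceI) (auto simp: ring_of_type_def)
qed

lemmas I_0 = A.subspace_0[OF subspace_I]
  and I_add = A.subspace_add[OF subspace_I]
  and I_diff = A.subspace_diff[OF subspace_I]
  and I_scale = A.subspace_scale[OF subspace_I]

lemma I_cong: "a - b \<in> I \<Longrightarrow> a \<in> I \<longleftrightarrow> b \<in> I"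
  using I_add[of "a - b" b] I_diff[of a "a - b"] by auto

lemma act_mult_filtered:
  assumes "A.subspace X" "h \<in> H.filt (Suc d)"
    and "\<And>p q y z. 1 \<le> p \<Longrightarrow> 1 \<le> q \<Longrightarrow> p + q \<le> d \<Longrightarrow> y \<in> H.aug_filt p \<Longrightarrow> z \<in> H.aug_filt q \<Longrightarrow>
      act y a * act z b \<in> X"
  shows "act h (a * b) - act h a * b - a * act h b + scaleA (\<epsilon> h) (a * b) \<in> X"
  using H.comult_filtered[OF bilin_act assms] by (simp add: act_mult_sweedler act_one_left)

text \<open>Every term of \<Delta> h other than h \<otimes> 1 has a left leg of smaller degree,
  which sends a into I. For n = 0 the element h is a scalar and the two remaining terms
  cancel.\<close>

lemma act_mult_right_mod_I:
  assumes low: "\<And>h. h \<in> H.filt n \<Longrightarrow> act h a \<in> I" and h: "h \<in> H.filt (Suc n)"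
  shows "act h (a * c) - act h a * c \<in> I"
proof -
  have *: "act h (a * c) - act h a * c - a * act h c + scaleA (\<epsilon> h) (a * c) \<in> I"
  proof (rule act_mult_filtered[OF subspace_I h])
    fix p q y z assume "1 \<le> q" "p + q \<le> n" "y \<in> H.aug_filt p"
    then have "y \<in> H.filt n"
      using H.aug_filt_subset[of p] H.filt_mono[of "Suc p" n] by auto
    then show "act y a * act z c \<in> I"
      by (intro I_mult low)
  qed
  have "a * act h c - scaleA (\<epsilon> h) (a * c) \<in> I"
  proof (cases n)
    case 0
    then have "h = scaleH (\<epsilon> h) 1"
      using h H.filt_1 by simp
    then obtain k where "h = scaleH k 1" ..
    then show ?thesis
      using I_0 by (simp add: act_simps act_one_left A.scale_mult_right)
  next
    case (Suc m)
    have "act 1 a \<in> I"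
      using H.one_mem_filt[of m] Suc low by blast
    then show ?thesis
      by (intro I_diff I_scale I_mult) (simp_all add: act_one_left)
  qed
  from I_add[OF * this] show ?thesis
    by (simp add: algebra_simps)
qed

lemma act_mult_right_low:
  assumes "\<And>h. h \<in> H.filt n \<Longrightarrow> act h a \<in> I" "h \<in> H.filt n"
  shows "act h (a * c) \<in> I"
proof (cases n)
  case 0
  then show ?thesis
    using assms(2) I_0 by (simp add: act_simps)
next
  case (Suc m)
  have "act h (a * c) - act h a * c \<in> I"
    using assms H.filt_Suc_mono[of m] unfolding Suc by (intro act_mult_right_mod_I[of m]) auto
  then show ?thesis
    using I_cong I_mult(2)[OF assms(1)[OF assms(2)]] by blast
qed

text \<open>
  The error terms of the Leibniz rule \<open>act_word\<close>: the middle terms of \<open>\<Delta> z\<close> split the letter \<open>z\<close> into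
  two, which raises the number of letters but not the degree.
\<close>

definition err :: "'a \<Rightarrow> 'a \<Rightarrow> nat \<Rightarrow> nat \<Rightarrow> 'a set"
  where "err a b d k = A.span {act (wval u) a * act (wval v) b |u v.
    H.valid_word u \<and> H.valid_word v \<and> wdeg u + wdeg v \<le> d \<and> k \<le> length u + length v}"

lemma subspace_err: "A.subspace (err a b d k)"
  by (simp add: err_def)

lemma err_base:
  "H.valid_word u \<Longrightarrow> H.valid_word v \<Longrightarrow> wdeg u + wdeg v \<le> d \<Longrightarrow> k \<le> length u + length v \<Longrightarrow>
    act (wval u) a * act (wval v) b \<in> err a b d k"
  unfolding err_def by (intro A.span_base) blast

text \<open>A letter of augmentation 0 acts as a derivation up to the middle terms of its
  comultiplication, and each of these prepends one new letter to u and another to v.\<close>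

lemma act_letter:
  assumes z: "1 \<le> snd z" "fst z \<in> H.aug_filt (snd z)" and uv: "H.valid_word u" "H.valid_word v"
  shows "act (fst z) (act (wval u) a * act (wval v) b)
      - (act (wval (z # u)) a * act (wval v) b + act (wval u) a * act (wval (z # v)) b)
    \<in> err a b (snd z + (wdeg u + wdeg v)) (Suc (Suc (length u + length v)))" (is "_ \<in> ?E")
proof -
  let ?a = "act (wval u) a" and ?b = "act (wval v) b"
  have "act (fst z) (?a * ?b) - act (fst z) ?a * ?b - ?a * act (fst z) ?b + scaleA (\<epsilon> (fst z)) (?a * ?b) \<in> ?E"
  proof (rule act_mult_filtered[OF subspace_err, of _ "snd z"])
    show "fst z \<in> H.filt (Suc (snd z))"
      using z H.aug_filt_subset by auto
    fix p q y w assume *: "1 \<le> p" "1 \<le> q" "p + q \<le> snd z" "y \<in> H.aug_filt p" "w \<in> H.aug_filt q"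
    have "act (wval ((y, p) # u)) a * act (wval ((w, q) # v)) b \<in> ?E"
      using * uv by (intro err_base) auto
    then show "act y ?a * act w ?b \<in> ?E"
      by (simp add: act_mult_left)
  qed
  moreover have "\<epsilon> (fst z) = 0"
    using z by (simp add: H.aug_filt_def)
  ultimately show ?thesis
    by (simp add: act_mult_left algebra_simps)
qed

text \<open>Both the derivation part and the middle terms add at least one letter and at most the
  degree of z.\<close>

lemma act_err:
  assumes z: "1 \<le> snd z" "fst z \<in> H.aug_filt (snd z)" and x: "x \<in> err a b d k"
  shows "act (fst z) x \<in> err a b (snd z + d) (Suc k)"
  using x unfolding err_def[of a b d k]
proof (induction rule: A.span_induct_alt)
  case base
  then show ?case
    using A.subspace_0[OF subspace_err] by (simp add: act_simps)
next
  case (step c x y)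
  then obtain u v where uv: "x = act (wval u) a * act (wval v) b" "H.valid_word u" "H.valid_word v"
    "wdeg u + wdeg v \<le> d" "k \<le> length u + length v" by blast
  let ?E = "err a b (snd z + d) (Suc k)"
  have "act (wval (z # u)) a * act (wval v) b + act (wval u) a * act (wval (z # v)) b \<in> ?E"
    using uv z by (intro A.subspace_add[OF subspace_err] err_base) auto
  moreover have "act (fst z) x - (act (wval (z # u)) a * act (wval v) b + act (wval u) a * act (wval (z # v)) b) \<in> ?E"
  proof -
    have "err a b (snd z + (wdeg u + wdeg v)) (Suc (Suc (length u + length v))) \<subseteq> ?E"
      unfolding err_def using uv(4,5) by (intro A.span_mono) force
    then show ?thesis
      using act_letter[OF z uv(2,3), of a b] unfolding uv(1) by blast
  qed
  ultimately have "act (fst z) x \<in> ?E"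
    using A.subspace_add[OF subspace_err] by fastforce
  then show ?case
    using step(2) by (simp add: act_simps A.subspace_add[OF subspace_err] A.subspace_scale[OF subspace_err])
qed

text \<open>The Leibniz rule applied letter by letter: z joins either the first or the second part
  of a split, which is the recursion of \<open>splits\<close>.\<close>

lemma act_word:
  assumes "H.valid_word w"
  shows "act (wval w) (a * b) - (\<Sum>(u, v)\<leftarrow>splits w. act (wval u) a * act (wval v) b)
    \<in> err a b (wdeg w) (Suc (length w))"
  using assms
proof (induction w)
  case Nil
  then show ?case
    using A.subspace_0[OF subspace_err] by (simp add: act_one_left)
next
  case (Cons z w)
  let ?E = "err a b (wdeg (z # w)) (Suc (length (z # w)))"
  define t :: "('h \<times> nat) list \<times> ('h \<times> nat) list \<Rightarrow> 'a"
    where "t p = act (wval (fst p)) a * act (wval (snd p)) b" for p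
  define t' where "t' p = t (z # fst p, snd p) + t (fst p, z # snd p)" for p
  have z: "1 \<le> snd z" "fst z \<in> H.aug_filt (snd z)" and w: "H.valid_word w"
    using Cons.prems by auto
  have sum: "act (fst z) (sum_list (map t xs)) - sum_list (map t' xs) \<in> ?E" if "set xs \<subseteq> set (splits w)" for xs
    using that
  proof (induction xs)
    case Nil
    then show ?case
      using A.subspace_0[OF subspace_err] by (simp add: act_simps)
  next
    case (Cons p xs)
    obtain u v where p: "p = (u, v)"
      by (cases p)
    have s: "(u, v) \<in> set (splits w)"
      using Cons.prems p by auto
    have "H.valid_word u" "H.valid_word v"
      using splits_facts[OF s] w H.valid_word_subset by blast+
    from act_letter[OF z this, of a b] have "act (fst z) (t p) - t' p \<in> ?E"
      using splits_facts(3)[OF s] splits_wdeg[OF s] by (simp add: t_def t'_def p)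
    from A.subspace_add[OF subspace_err this Cons.IH] Cons.prems show ?case
      by (simp add: act_simps algebra_simps)
  qed
  have splits_sum: "(\<Sum>(u, v)\<leftarrow>splits (z # w). act (wval u) a * act (wval v) b) = sum_list (map t' (splits w))"
    by (simp add: case_prod_unfold t_def[abs_def] t'_def[abs_def] sum_list_addf comp_def)
  have "act (fst z) (act (wval w) (a * b) - sum_list (map t (splits w))) \<in> ?E"
    using act_err[OF z Cons.IH[OF w]] by (simp add: t_def[abs_def] case_prod_unfold)
  from A.subspace_add[OF subspace_err this sum[OF order_refl]] show ?case
    unfolding splits_sum by (simp add: act_simps act_mult_left)
qed

section \<open>Leading degree and leading length\<close>

lemma not_core_iff: "a \<notin> core I \<longleftrightarrow> (\<exists>h. act h a \<notin> I)"
  by (simp add: core_def)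

text \<open>
  \<open>n\<close> is the order of \<open>a\<close> for the coradical filtration, and \<open>j\<close> the largest number of factors of a
  product of degree \<open>n\<close> that does not send \<open>a\<close> into \<open>I\<close>.
\<close>

definition leading :: "'a \<Rightarrow> nat \<Rightarrow> nat \<Rightarrow> bool"
  where "leading a n j \<longleftrightarrow> (\<forall>h\<in>H.filt n. act h a \<in> I) \<and>
    (\<forall>w. H.valid_word w \<and> wdeg w = n \<and> j < length w \<longrightarrow> act (wval w) a \<in> I)"

text \<open>The order n exists since the filtration is exhaustive. Letters have degree at least 1,
  so lengths of words of degree n are bounded by n and a largest one exists.\<close>

lemma leading_exists:
  assumes "a \<notin> core I"
  shows "\<exists>n j w. leading a n j \<and> H.valid_word w \<and> wdeg w = n \<and> length w = j \<and> act (wval w) a \<notin> I"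
proof -
  define N where "N n \<longleftrightarrow> (\<exists>h\<in>H.filt (Suc n). act h a \<notin> I)" for n
  obtain h n0 where "act h a \<notin> I" "h \<in> H.filt n0"
    using assms H.filt_exhaustive not_core_iff by blast
  then have "N n0"
    using H.filt_Suc_mono unfolding N_def by blast
  define n where "n = (LEAST n. N n)"
  have "N n"
    using \<open>N n0\<close> unfolding n_def by (rule LeastI)
  have low: "\<not> N m" if "m < n" for m
    using that unfolding n_def by (rule not_less_Least)
  have kill: "act g a \<in> I" if "g \<in> H.filt n" for g
  proof (cases n)
    case 0
    then show ?thesis
      using that I_0 by (simp add: act_simps)
  next
    case (Suc m)
    then show ?thesis
      using that low[of m] unfolding N_def by blast
  qed
  obtain h where h: "h \<in> H.filt (Suc n)" "act h a \<notin> I"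
    using \<open>N n\<close> unfolding N_def by blast
  define J where "J k \<longleftrightarrow> (\<exists>w. H.valid_word w \<and> wdeg w = n \<and> length w = k \<and> act (wval w) a \<notin> I)" for k
  have "\<exists>k. J k"
  proof (cases n)
    case 0
    then have "h = scaleH (\<epsilon> h) 1"
      using h(1) H.filt_1 by simp
    then have "act h a = scaleA (\<epsilon> h) a"
      using act_simps(4)[of "\<epsilon> h" 1 a] by (simp add: act_one_left)
    then have "a \<notin> I"
      using h(2) I_scale by auto
    then have "J 0"
      unfolding J_def using 0 by (auto simp: act_one_left intro!: exI[of _ "[]"])
    then show ?thesis ..
  next
    case (Suc m)
    \<comment> \<open>Removing the scalar part does not matter modulo I because n > 0 forces a into
      I; what remains is a word with one letter.\<close>
    let ?h = "h - scaleH (\<epsilon> h) 1"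
    have "act 1 a \<in> I"
      using kill H.one_mem_filt[of m] Suc by blast
    then have "act ?h a \<notin> I"
      using h(2) I_cong[of "act h a" "act ?h a"] I_scale by (simp add: act_simps)
    moreover have "?h \<in> H.aug_filt n"
      using h(1) by (rule H.sub_counit_aug_filt)
    ultimately have "J 1"
      unfolding J_def using Suc by (intro exI[of _ "[(?h, n)]"]) auto
    then show ?thesis ..
  qed
  moreover have "\<forall>k. J k \<longrightarrow> k \<le> n"
    unfolding J_def using H.length_le_wdeg by blast
  ultimately obtain j where j: "J j" "\<And>k. J k \<Longrightarrow> k \<le> j"
    using Nat.ex_has_greatest_nat[of J _ n] by metis
  have "act (wval w) a \<in> I" if "H.valid_word w" "wdeg w = n" "j < length w" for w
    using j(2)[of "length w"] that unfolding J_def by fastforce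
  then have "leading a n j"
    unfolding leading_def using kill by blast
  then show ?thesis
    using j(1) unfolding J_def by blast
qed

lemma leading_mult_right:
  assumes "leading a n j"
  shows "leading (a * c) n j"
    and "H.valid_word w \<Longrightarrow> wdeg w = n \<Longrightarrow> act (wval w) (a * c) - act (wval w) a * c \<in> I"
proof -
  have low: "act h a \<in> I" if "h \<in> H.filt n" for h
    using assms that by (simp add: leading_def)
  show *: "act (wval w) (a * c) - act (wval w) a * c \<in> I" if "H.valid_word w" "wdeg w = n" for w
    using act_mult_right_mod_I[OF low] H.wval_filt[OF that(1)] that(2) by blast
  have "act (wval w) (a * c) \<in> I" if "H.valid_word w" "wdeg w = n" "j < length w" for w
    using assms that I_cong[OF *] I_mult(2) by (simp add: leading_def)
  then show "leading (a * c) n j"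
    using act_mult_right_low[OF low] by (simp add: leading_def)
qed

text \<open>Pigeonhole: either one of the two degrees is below its order, or both are equal to it
  and one of the words is too long.\<close>

lemma err_subset_I:
  assumes a: "leading a n j" and b: "leading b m l"
  shows "err a b (n + m) (Suc (j + l)) \<subseteq> I"
  unfolding err_def
proof (rule A.span_minimal[OF _ subspace_I], clarify)
  fix u v :: "('h \<times> nat) list"
  assume *: "H.valid_word u" "H.valid_word v" "wdeg u + wdeg v \<le> n + m" "Suc (j + l) \<le> length u + length v"
  consider "wdeg u < n" | "wdeg v < m" | "wdeg u = n" "wdeg v = m"
    using *(3) by linarith
  then have "act (wval u) a \<in> I \<or> act (wval v) b \<in> I"
  proof cases
    case 1
    then have "wval u \<in> H.filt n"
      using H.wval_filt[OF *(1)] H.filt_mono[of "Suc (wdeg u)" n] by auto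
    then show ?thesis
      using a by (simp add: leading_def)
  next
    case 2
    then have "wval v \<in> H.filt m"
      using H.wval_filt[OF *(2)] H.filt_mono[of "Suc (wdeg v)" m] by auto
    then show ?thesis
      using b by (simp add: leading_def)
  next
    case 3
    then have "j < length u \<or> l < length v"
      using *(4) by linarith
    then show ?thesis
      using 3 * a b by (auto simp: leading_def)
  qed
  then show "act (wval u) a * act (wval v) b \<in> I"
    using I_mult by blast
qed

text \<open>N counts the summands outside I, all of which are congruent to t.\<close>

lemma sum_list_mod_I:
  assumes "\<And>x. x \<in> set xs \<Longrightarrow> f x \<in> I \<or> f x - t \<in> I"
  obtains N where "sum_list (map f xs) - scaleA (of_nat N) t \<in> I"
    "(\<exists>x\<in>set xs. f x \<notin> I) \<Longrightarrow> 0 < N"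
  using assms
proof (induction xs arbitrary: thesis)
  case Nil
  show ?case by (rule Nil(1)[of 0]) (simp_all add: I_0)
next
  case (Cons x xs)
  obtain N where N: "sum_list (map f xs) - scaleA (of_nat N) t \<in> I"
    "(\<exists>x\<in>set xs. f x \<notin> I) \<Longrightarrow> 0 < N"
    using Cons.IH Cons.prems(2) by (metis list.set_intros(2))
  show ?case
  proof (cases "f x \<in> I")
    case True
    then show ?thesis
      using N I_add[OF True N(1)] by (intro Cons.prems(1)[of N]) (auto simp: algebra_simps)
  next
    case False
    then have "f x - t \<in> I"
      using Cons.prems(2)[of x] by auto
    then show ?thesis
      using N I_add[of "f x - t", OF _ N(1)]
      by (intro Cons.prems(1)[of "Suc N"]) (auto simp: algebra_simps A.scale_left_distrib)
  qed
qed

text \<open>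
  The letters are indexed by natural numbers in order that monomials, that is, words up to
  permutation, are linearly ordered by the multiset order.
\<close>

lemma mult_not_core:
  fixes e :: "nat \<Rightarrow> 'h \<times> nat"
  assumes a: "leading a n j" and b: "leading b m l"
    and u: "H.valid_word (map e u)" "wdeg (map e u) = n" "length u = j"
    and v: "H.valid_word (map e v)" "wdeg (map e v) = m" "length v = l"
    and max_u: "\<And>u'. set u' \<subseteq> set (u @ v) \<Longrightarrow> length u' = j \<Longrightarrow> wdeg (map e u') = n \<Longrightarrow>
      act (wval (map e u')) a \<notin> I \<Longrightarrow> mset u' \<le> mset u"
    and max_v: "\<And>v'. set v' \<subseteq> set (u @ v) \<Longrightarrow> length v' = l \<Longrightarrow> wdeg (map e v') = m \<Longrightarrow>
      act (wval (map e v')) b \<notin> I \<Longrightarrow> mset v' \<le> mset v"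
    and nz: "act (wval (map e u)) a * act (wval (map e v)) b \<notin> I"
  shows "a * b \<notin> core I"
proof -
  define t where "t = act (wval (map e u)) a * act (wval (map e v)) b"
  define f where "f p = act (wval (map e (fst p))) a * act (wval (map e (snd p))) b" for p
  let ?w = "u @ v"
  have valid: "H.valid_word (map e ?w)"
    using u v by simp
  \<comment> \<open>Permuting the letters of a word of degree k changes its value by an element of
    \<open>filt k\<close>, which sends c into I.\<close>
  have eq_mod: "act (wval (map e u')) c - act (wval (map e u'')) c \<in> I"
    if "leading c k i" "H.valid_word (map e u')" "wdeg (map e u') = k" "mset u' = mset u''" for c k i u' u''
    using H.wval_mset_cong[of "map e u'" "map e u''"] that
    by (simp add: leading_def act_simps(2)[symmetric])
  have terms: "f p \<in> I \<or> f p - t \<in> I" if p_mem: "p \<in> set (splits ?w)" for p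
  proof -
    obtain u' v' where p: "p = (u', v')"
      by (cases p)
    note s = p_mem[unfolded p]
    have ms: "mset u' + mset v' = mset u + mset v"
      using splits_mset[OF s] by simp
    have sub: "set u' \<subseteq> set ?w" "set v' \<subseteq> set ?w"
      using splits_facts[OF s] by auto
    have val: "H.valid_word (map e u')" "H.valid_word (map e v')"
      by (rule H.valid_word_subset[OF valid], unfold set_map, rule image_mono, rule sub)+
    have "(map e u', map e v') \<in> set (splits (map e ?w))"
      unfolding splits_map using s by force
    then have deg: "wdeg (map e u') + wdeg (map e v') = n + m"
      using splits_wdeg u(2) v(2) by fastforce
    show ?thesis
    proof (cases "act (wval (map e u')) a \<in> I \<or> act (wval (map e v')) b \<in> I")
      case True
      then show ?thesis
        using I_mult by (auto simp: f_def p)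
    next
      case False
      have "\<not> wdeg (map e u') < n"
        using False a H.wval_filt[OF val(1)] H.filt_mono[of "Suc (wdeg (map e u'))" n]
        by (fastforce simp: leading_def)
      moreover have "\<not> wdeg (map e v') < m"
        using False b H.wval_filt[OF val(2)] H.filt_mono[of "Suc (wdeg (map e v'))" m]
        by (fastforce simp: leading_def)
      ultimately have deg': "wdeg (map e u') = n" "wdeg (map e v') = m"
        using deg by linarith+
      have "\<not> j < length u'" "\<not> l < length v'"
        using False a b val deg' unfolding leading_def by (metis length_map)+
      moreover have "length u' + length v' = j + l"
        using splits_facts(3)[OF s] u(3) v(3) by simp
      ultimately have len: "length u' = j" "length v' = l"
        by linarith+
      have le: "mset u' \<le> mset u" "mset v' \<le> mset v"
        using max_u max_v sub len deg' False by blast+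
      \<comment> \<open>The multiset order is compatible with addition: a strict drop in one factor
        could not be compensated by the other, yet both pairs have the same total.\<close>
      have "mset u' = mset u"
      proof (rule ccontr)
        assume "mset u' \<noteq> mset u"
        then have "mset u' < mset u"
          using le(1) by simp
        then have "mset u' + mset v' < mset u + mset v"
          using le(2) by (rule add_less_le_mono)
        then show False
          using ms by simp
      qed
      moreover from this have "mset v' = mset v"
        using ms by simp
      ultimately have d: "act (wval (map e u')) a - act (wval (map e u)) a \<in> I"
          "act (wval (map e v')) b - act (wval (map e v)) b \<in> I"
        using eq_mod[OF a val(1) deg'(1)] eq_mod[OF b val(2) deg'(2)] by blast+
      have "(act (wval (map e u')) a - act (wval (map e u)) a) * act (wval (map e v')) b
          + act (wval (map e u)) a * (act (wval (map e v')) b - act (wval (map e v)) b) \<in> I"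
        by (intro I_add I_mult d)
      then show ?thesis
        by (simp add: f_def t_def p algebra_simps)
    qed
  qed
  \<comment> \<open>N is the number of splits that yield the leading term; it is positive because
    (u, v) is one of them.\<close>
  obtain N where N: "sum_list (map f (splits ?w)) - scaleA (of_nat N) t \<in> I"
    "(\<exists>p\<in>set (splits ?w). f p \<notin> I) \<Longrightarrow> 0 < N"
    using sum_list_mod_I[of "splits ?w" f t] terms by blast
  have "f (u, v) \<notin> I"
    using nz by (simp add: f_def)
  then have "0 < N"
    using N(2) splits_append by blast
  have "act (wval (map e ?w)) (a * b) - sum_list (map f (splits ?w)) \<in> I"
  proof -
    have "(\<Sum>(u, v)\<leftarrow>splits (map e ?w). act (wval u) a * act (wval v) b) = sum_list (map f (splits ?w))"
      unfolding splits_map by (simp add: case_prod_unfold comp_def f_def[abs_def])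
    moreover have "wdeg (map e ?w) = n + m" "length (map e ?w) = j + l"
      using u v by simp_all
    ultimately show ?thesis
      using act_word[OF valid, of a b] err_subset_I[OF a b] by auto
  qed
  from I_add[OF this N(1)] have *: "act (wval (map e ?w)) (a * b) - scaleA (of_nat N) t \<in> I"
    by simp
  have "scaleA (of_nat N) t \<notin> I"
  proof
    assume "scaleA (of_nat N) t \<in> I"
    then have "scaleA (inverse (of_nat N)) (scaleA (of_nat N) t) \<in> I"
      by (rule I_scale)
    then show False
      using \<open>0 < N\<close> nz by (simp add: t_def)
  qed
  then have "act (wval (map e ?w)) (a * b) \<notin> I"
    using I_cong[OF *] by simp
  then show ?thesis
    using not_core_iff by blast
qed

text \<open>Reduces every kind of primeness of the core to that of I: h and k are values of the
  maximal leading monomials and do not depend on c. Equal h and k for a = b serve the semiprime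
  case.\<close>

lemma core_mult_reflect:
  assumes a: "a \<notin> core I" and b: "b \<notin> core I"
  obtains h k where "act h a \<notin> I" "act k b \<notin> I" "a = b \<Longrightarrow> h = k"
    "\<And>c. act h a * c * act k b \<notin> I \<Longrightarrow> a * c * b \<notin> core I"
proof -
  \<comment> \<open>The data are chosen as functions of the element, so that a = b gives the same
    choices twice.\<close>
  have "\<forall>x. \<exists>n j w. x \<notin> core I \<longrightarrow>
      leading x n j \<and> H.valid_word w \<and> wdeg w = n \<and> length w = j \<and> act (wval w) x \<notin> I"
    using leading_exists by blast
  then obtain n j w where lead: "\<And>x. x \<notin> core I \<Longrightarrow> leading x (n x) (j x) \<and> H.valid_word (w x) \<and>
      wdeg (w x) = n x \<and> length (w x) = j x \<and> act (wval (w x)) x \<notin> I"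
    by metis
  \<comment> \<open>A finite common alphabet for a and b; positions in this list supply the linear
    order of the letters.\<close>
  define zs where "zs = w a @ w b"
  define e where "e i = zs ! i" for i
  define G where "G x = {u. set u \<subseteq> {..<length zs} \<and> length u = j x \<and> wdeg (map e u) = n x \<and>
    act (wval (map e u)) x \<notin> I}" for x
  have valid: "H.valid_word zs"
    using lead[OF a] lead[OF b] by (simp add: zs_def)
  have validG: "H.valid_word (map e u)" if "set u \<subseteq> {..<length zs}" for u
    using that by (intro H.valid_word_subset[OF valid]) (auto simp: e_def)
  have finG: "finite (G x)" for x
    by (rule finite_subset[OF _ finite_lists_length_eq[of "{..<length zs}" "j x"]]) (auto simp: G_def)
  have "\<exists>u. x \<notin> core I \<and> (x = a \<or> x = b) \<longrightarrow> u \<in> G x \<and> (\<forall>u'\<in>G x. mset u' \<le> mset u)" for x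
  proof (cases "x \<notin> core I \<and> (x = a \<or> x = b)")
    case True
    then have "set (w x) \<subseteq> set zs"
      by (auto simp: zs_def)
    then obtain u where "set u \<subseteq> {..<length zs}" "map e u = w x"
      using indices_exist[of "w x" zs] unfolding e_def by blast
    then have "u \<in> G x"
      using lead[of x] True by (auto simp: G_def dest: arg_cong[of _ _ length])
    \<comment> \<open>The leading monomial: words of fixed length over a finite alphabet are finite
      in number, and multisets of indices are linearly ordered.\<close>
    then have "Max (mset ` G x) \<in> mset ` G x"
      using finG by (intro Max_in) auto
    then obtain u' where "u' \<in> G x" "mset u' = Max (mset ` G x)"
      by auto
    then show ?thesis
      using finG by auto
  qed auto
  then obtain W where W: "\<And>x. x \<notin> core I \<and> (x = a \<or> x = b) \<Longrightarrow> W x \<in> G x \<and> (\<forall>u'\<in>G x. mset u' \<le> mset (W x))"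
    by metis
  have Wa: "W a \<in> G a" "\<And>u. u \<in> G a \<Longrightarrow> mset u \<le> mset (W a)"
    and Wb: "W b \<in> G b" "\<And>u. u \<in> G b \<Longrightarrow> mset u \<le> mset (W b)"
    using W[of a] W[of b] a b by blast+
  define h where "h x = wval (map e (W x))" for x
  show ?thesis
  proof (rule that[of "h a" "h b"])
    show "act (h a) a \<notin> I" "act (h b) b \<notin> I"
      using Wa(1) Wb(1) by (auto simp: G_def h_def)
    show "h a = h b" if "a = b"
      using that by simp
    fix c assume nz: "act (h a) a * c * act (h b) b \<notin> I"
    have la: "leading a (n a) (j a)"
      using lead[OF a] by blast
    have sub: "set (W a @ W b) \<subseteq> {..<length zs}"
      using Wa(1) Wb(1) by (auto simp: G_def)
    show "a * c * b \<notin> core I"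
    proof (rule mult_not_core[of _ "n a" "j a" b "n b" "j b" e "W a" "W b"])
      show "leading (a * c) (n a) (j a)" "leading b (n b) (j b)"
        using leading_mult_right(1)[OF la] lead[OF b] by auto
      show "H.valid_word (map e (W a))" "wdeg (map e (W a)) = n a" "length (W a) = j a"
        "H.valid_word (map e (W b))" "wdeg (map e (W b)) = n b" "length (W b) = j b"
        using Wa(1) Wb(1) validG by (auto simp: G_def)
      show "mset u \<le> mset (W a)"
        if "set u \<subseteq> set (W a @ W b)" "length u = j a" "wdeg (map e u) = n a"
          "act (wval (map e u)) (a * c) \<notin> I" for u
      proof (rule Wa(2))
        have su: "set u \<subseteq> {..<length zs}"
          using that(1) sub by blast
        \<comment> \<open>Modulo I a word of degree \<open>n a\<close> acts on a c as on a, followed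
          by multiplication by c, so maximality for a implies it for a c.\<close>
        have "act (wval (map e u)) a \<notin> I"
          using that(4) I_cong[OF leading_mult_right(2)[OF la validG[OF su] that(3)]] I_mult(2) by blast
        then show "u \<in> G a"
          using that su by (simp add: G_def)
      qed
      show "mset u \<le> mset (W b)"
        if "set u \<subseteq> set (W a @ W b)" "length u = j b" "wdeg (map e u) = n b"
          "act (wval (map e u)) b \<notin> I" for u
        using that sub by (intro Wb(2)) (auto simp: G_def)
      have "(act (h a) (a * c) - act (h a) a * c) * act (h b) b \<in> I"
        unfolding h_def using Wa(1) validG
        by (intro I_mult(2) leading_mult_right(2)[OF la]) (auto simp: G_def)
      then have "act (h a) (a * c) * act (h b) b - act (h a) a * c * act (h b) b \<in> I"
        by (simp add: left_diff_distrib)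
      then show "act (wval (map e (W a))) (a * c) * act (wval (map e (W b))) b \<notin> I"
        using nz I_cong by (auto simp: h_def)
    qed
  qed
qed

end

section \<open>Prime, semiprime and completely prime ideals elementwise\<close>

context ring
begin

text \<open>The z with X R z = 0. The ring in the middle makes this a two-sided ideal.\<close>

definition left_annihilated :: "'a set \<Rightarrow> 'a set"
  where "left_annihilated X = {z \<in> carrier R. \<forall>x\<in>X. \<forall>y\<in>carrier R. x \<otimes> y \<otimes> z = \<zero>}"

definition right_annihilated :: "'a set \<Rightarrow> 'a set"
  where "right_annihilated X = {z \<in> carrier R. \<forall>x\<in>X. \<forall>y\<in>carrier R. z \<otimes> y \<otimes> x = \<zero>}"

lemma ideal_left_annihilated:
  assumes X: "X \<subseteq> carrier R"
  shows "ideal (left_annihilated X) R"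
proof (rule idealI[OF ring_axioms])
  show "subgroup (left_annihilated X) (add_monoid R)"
  proof (rule add.subgroupI)
    show "left_annihilated X \<noteq> {}"
      using X by (auto simp: left_annihilated_def subset_iff intro!: exI[of _ \<zero>])
  qed (use X in \<open>auto simp: left_annihilated_def subset_iff r_distr r_minus a_inv_def[symmetric]\<close>)
  show "y \<otimes> z \<in> left_annihilated X" if z: "z \<in> left_annihilated X" and y: "y \<in> carrier R" for z y
  proof -
    have "x \<otimes> y' \<otimes> (y \<otimes> z) = \<zero>" if "x \<in> X" "y' \<in> carrier R" for x y'
    proof -
      have "x \<otimes> y' \<otimes> (y \<otimes> z) = x \<otimes> (y' \<otimes> y) \<otimes> z"
        using that y z X by (simp add: left_annihilated_def m_assoc subset_iff)
      then show ?thesis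
        using that y z by (simp add: left_annihilated_def)
    qed
    then show ?thesis
      using y z by (simp add: left_annihilated_def)
  qed
  show "z \<otimes> y \<in> left_annihilated X" if "z \<in> left_annihilated X" "y \<in> carrier R" for z y
    using that X by (auto simp: left_annihilated_def subset_iff m_assoc[symmetric])
qed

lemma ideal_right_annihilated:
  assumes X: "X \<subseteq> carrier R"
  shows "ideal (right_annihilated X) R"
proof (rule idealI[OF ring_axioms])
  show "subgroup (right_annihilated X) (add_monoid R)"
  proof (rule add.subgroupI)
    show "right_annihilated X \<noteq> {}"
      using X by (auto simp: right_annihilated_def subset_iff intro!: exI[of _ \<zero>])
  qed (use X in \<open>auto simp: right_annihilated_def subset_iff l_distr l_minus a_inv_def[symmetric]\<close>)
  show "z \<otimes> y \<in> right_annihilated X" if z: "z \<in> right_annihilated X" and y: "y \<in> carrier R" for z y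
  proof -
    have "z \<otimes> y \<otimes> y' \<otimes> x = \<zero>" if "x \<in> X" "y' \<in> carrier R" for x y'
    proof -
      have "z \<otimes> y \<otimes> y' \<otimes> x = z \<otimes> (y \<otimes> y') \<otimes> x"
        using that y z X by (simp add: right_annihilated_def m_assoc subset_iff)
      then show ?thesis
        using that y z by (simp add: right_annihilated_def)
    qed
    then show ?thesis
      using y z by (simp add: right_annihilated_def)
  qed
  show "y \<otimes> z \<in> right_annihilated X" if "z \<in> right_annihilated X" "y \<in> carrier R" for z y
    using that X by (auto simp: right_annihilated_def subset_iff m_assoc)
qed

lemma ideal_prod_zeroI:
  assumes "ideal J R" "ideal K R" "\<And>x y. x \<in> J \<Longrightarrow> y \<in> K \<Longrightarrow> x \<otimes> y = \<zero>"
  shows "ideal_prod R J K = {\<zero>}"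
proof
  show "ideal_prod R J K \<subseteq> {\<zero>}"
  proof
    fix s assume "s \<in> ideal_prod R J K"
    then show "s \<in> {\<zero>}"
      by induction (use assms(3) in auto)
  qed
  have "\<zero> \<in> J" "\<zero> \<in> K"
    using assms(1,2) by (simp_all add: additive_subgroup.zero_closed ideal.axioms(1))
  then have "\<zero> \<otimes> \<zero> \<in> ideal_prod R J K"
    by (rule ideal_prod.prod)
  then show "{\<zero>} \<subseteq> ideal_prod R J K"
    by simp
qed

lemma mult_eq_0_if_ideal_prod_zero:
  assumes "ideal J R" "ideal_prod R J K = {\<zero>}" "a \<in> J" "b \<in> K" "y \<in> carrier R"
  shows "a \<otimes> y \<otimes> b = \<zero>"
  using ideal_prod.prod[OF ideal.I_r_closed[OF assms(1,3,5)] assms(4), of R] assms(2) by simp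

lemma annihilated_mult:
  assumes "x \<in> X" "X \<subseteq> carrier R" "z \<in> left_annihilated X"
  shows "x \<otimes> z = \<zero>"
proof -
  have "x \<otimes> \<one> \<otimes> z = \<zero>"
    using assms(1,3) by (simp add: left_annihilated_def)
  then show ?thesis
    using assms(1,2) by (simp add: subset_iff)
qed

text \<open>If a R b = 0, then J = {z. z R b = 0} contains a and K = {z. J R z = 0} contains b,
  while J K = 0. Annihilators replace generated ideals. Conversely, nonzero elements of two ideals
  with product 0 violate the elementwise condition.\<close>

lemma prime_ring_iff:
  "prime_ring R \<longleftrightarrow> \<one> \<noteq> \<zero> \<and>
    (\<forall>a\<in>carrier R. \<forall>b\<in>carrier R. (\<forall>y\<in>carrier R. a \<otimes> y \<otimes> b = \<zero>) \<longrightarrow> a = \<zero> \<or> b = \<zero>)"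
proof (intro iffI conjI ballI impI)
  assume P: "prime_ring R"
  then show "\<one> \<noteq> \<zero>"
    by (simp add: prime_ring_def)
  fix a b assume ab: "a \<in> carrier R" "b \<in> carrier R" "\<forall>y\<in>carrier R. a \<otimes> y \<otimes> b = \<zero>"
  let ?J = "right_annihilated {b}"
  let ?K = "left_annihilated ?J"
  have J: "?J \<subseteq> carrier R"
    by (auto simp: right_annihilated_def)
  then have JK: "ideal ?J R" "ideal ?K R"
    using ab by (auto intro!: ideal_right_annihilated ideal_left_annihilated)
  have "ideal_prod R ?J ?K = {\<zero>}"
    using J JK annihilated_mult by (intro ideal_prod_zeroI) auto
  then have "?J = {\<zero>} \<or> ?K = {\<zero>}"
    using P JK unfolding prime_ring_def by blast
  moreover have "a \<in> ?J" "b \<in> ?K"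
    using ab by (auto simp: right_annihilated_def left_annihilated_def)
  ultimately show "a = \<zero> \<or> b = \<zero>"
    by blast
next
  assume *: "\<one> \<noteq> \<zero> \<and>
    (\<forall>a\<in>carrier R. \<forall>b\<in>carrier R. (\<forall>y\<in>carrier R. a \<otimes> y \<otimes> b = \<zero>) \<longrightarrow> a = \<zero> \<or> b = \<zero>)"
  have "J = {\<zero>} \<or> K = {\<zero>}" if JK: "ideal J R" "ideal K R" "ideal_prod R J K = {\<zero>}" for J K
  proof (rule ccontr)
    assume n: "\<not> (J = {\<zero>} \<or> K = {\<zero>})"
    have "\<zero> \<in> J" "\<zero> \<in> K"
      using JK by (simp_all add: additive_subgroup.zero_closed ideal.axioms(1))
    then obtain a b where ab: "a \<in> J" "a \<noteq> \<zero>" "b \<in> K" "b \<noteq> \<zero>"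
      using n by blast
    then have "a \<in> carrier R" "b \<in> carrier R"
      using ideal.Icarr[OF JK(1)] ideal.Icarr[OF JK(2)] by simp_all
    then show False
      using * ab mult_eq_0_if_ideal_prod_zero[OF JK(1,3) ab(1,3)] by blast
  qed
  then show "prime_ring R"
    using * ring_axioms unfolding prime_ring_def by blast
qed

text \<open>As in the prime case, but with the intersection of the two annihilators, a single ideal
  of square 0 that contains a.\<close>

lemma semiprime_ring_iff:
  "semiprime_ring R \<longleftrightarrow> (\<forall>a\<in>carrier R. (\<forall>y\<in>carrier R. a \<otimes> y \<otimes> a = \<zero>) \<longrightarrow> a = \<zero>)"
proof (intro iffI ballI impI)
  assume P: "semiprime_ring R"
  fix a assume a: "a \<in> carrier R" "\<forall>y\<in>carrier R. a \<otimes> y \<otimes> a = \<zero>"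
  let ?J = "right_annihilated {a}"
  let ?L = "?J \<inter> left_annihilated ?J"
  have J: "?J \<subseteq> carrier R"
    by (auto simp: right_annihilated_def)
  then have L: "ideal ?L R"
    using a by (auto intro!: i_intersect ideal_right_annihilated ideal_left_annihilated)
  have "ideal_prod R ?L ?L = {\<zero>}"
    using J L annihilated_mult by (intro ideal_prod_zeroI) auto
  then have "?L = {\<zero>}"
    using P L unfolding semiprime_ring_def by blast
  moreover have "a \<in> ?L"
    using a by (auto simp: right_annihilated_def left_annihilated_def)
  ultimately show "a = \<zero>"
    by blast
next
  assume *: "\<forall>a\<in>carrier R. (\<forall>y\<in>carrier R. a \<otimes> y \<otimes> a = \<zero>) \<longrightarrow> a = \<zero>"
  have "J = {\<zero>}" if J: "ideal J R" "ideal_prod R J J = {\<zero>}" for J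
  proof -
    have "\<zero> \<in> J"
      using J by (simp add: additive_subgroup.zero_closed ideal.axioms(1))
    moreover have "a = \<zero>" if "a \<in> J" for a
      using * ideal.Icarr[OF J(1) that] mult_eq_0_if_ideal_prod_zero[OF J that that] by blast
    ultimately show ?thesis by blast
  qed
  then show "semiprime_ring R"
    using ring_axioms unfolding semiprime_ring_def by blast
qed

end

text \<open>The projection is characterized by its properties alone, so that the elementwise
  criteria pass to the quotient by rewriting.\<close>

lemma quotient_ring_of_type:
  fixes I :: "'a::{ring, monoid_mult} set"
  assumes I: "ideal I ring_of_type"
  obtains \<pi> where "carrier (ring_of_type Quot I) = range \<pi>"
    "\<And>x y. \<pi> x \<otimes>\<^bsub>ring_of_type Quot I\<^esub> \<pi> y = \<pi> (x * y)"
    "\<one>\<^bsub>ring_of_type Quot I\<^esub> = \<pi> 1"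
    "\<And>x. \<pi> x = \<zero>\<^bsub>ring_of_type Quot I\<^esub> \<longleftrightarrow> x \<in> I"
proof -
  let ?R = "ring_of_type :: 'a ring"
  interpret I: ideal I ?R by (rule I)
  have R: "carrier ?R = UNIV" "x \<otimes>\<^bsub>?R\<^esub> y = x * y" "\<one>\<^bsub>?R\<^esub> = 1" for x y
    by (simp_all add: ring_of_type_def)
  show ?thesis
  proof (rule that[of "\<lambda>x. I +>\<^bsub>?R\<^esub> x"])
    show "carrier (?R Quot I) = range (\<lambda>x. I +>\<^bsub>?R\<^esub> x)"
      by (auto simp: FactRing_def A_RCOSETS_def' R)
    show "(I +>\<^bsub>?R\<^esub> x) \<otimes>\<^bsub>?R Quot I\<^esub> (I +>\<^bsub>?R\<^esub> y) = I +>\<^bsub>?R\<^esub> (x * y)" for x y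
      using I.rcoset_mult_add[of x y] by (simp add: FactRing_def R)
    show "\<one>\<^bsub>?R Quot I\<^esub> = I +>\<^bsub>?R\<^esub> 1"
      by (simp add: FactRing_def R)
    show "I +>\<^bsub>?R\<^esub> x = \<zero>\<^bsub>?R Quot I\<^esub> \<longleftrightarrow> x \<in> I" for x
      using I.a_rcos_self[of x] I.a_rcos_const[of x] by (auto simp: FactRing_def R)
  qed
qed

lemma prime_ideal_iff:
  assumes I: "ideal I ring_of_type"
  shows "prime_ideal I \<longleftrightarrow> 1 \<notin> I \<and> (\<forall>a b. (\<forall>c. a * c * b \<in> I) \<longrightarrow> a \<in> I \<or> b \<in> I)"
proof -
  obtain \<pi> where \<pi>: "carrier (ring_of_type Quot I) = range \<pi>"
    "\<And>x y. \<pi> x \<otimes>\<^bsub>ring_of_type Quot I\<^esub> \<pi> y = \<pi> (x * y)"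
    "\<one>\<^bsub>ring_of_type Quot I\<^esub> = \<pi> 1"
    "\<And>x. \<pi> x = \<zero>\<^bsub>ring_of_type Quot I\<^esub> \<longleftrightarrow> x \<in> I"
    using quotient_ring_of_type[OF I] by blast
  interpret Q: ring "ring_of_type Quot I"
    by (rule ideal.quotient_is_ring[OF I])
  show ?thesis
    unfolding prime_ideal_def Q.prime_ring_iff using I by (simp add: \<pi>)
qed

lemma semiprime_ideal_iff:
  assumes I: "ideal I ring_of_type"
  shows "semiprime_ideal I \<longleftrightarrow> (\<forall>a. (\<forall>c. a * c * a \<in> I) \<longrightarrow> a \<in> I)"
proof -
  obtain \<pi> where \<pi>: "carrier (ring_of_type Quot I) = range \<pi>"
    "\<And>x y. \<pi> x \<otimes>\<^bsub>ring_of_type Quot I\<^esub> \<pi> y = \<pi> (x * y)"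
    "\<one>\<^bsub>ring_of_type Quot I\<^esub> = \<pi> 1"
    "\<And>x. \<pi> x = \<zero>\<^bsub>ring_of_type Quot I\<^esub> \<longleftrightarrow> x \<in> I"
    using quotient_ring_of_type[OF I] by blast
  interpret Q: ring "ring_of_type Quot I"
    by (rule ideal.quotient_is_ring[OF I])
  show ?thesis
    unfolding semiprime_ideal_def Q.semiprime_ring_iff using I by (simp add: \<pi>)
qed

lemma completely_prime_ideal_iff:
  assumes I: "ideal I ring_of_type"
  shows "completely_prime_ideal I \<longleftrightarrow> 1 \<notin> I \<and> (\<forall>a b. a * b \<in> I \<longrightarrow> a \<in> I \<or> b \<in> I)"
proof -
  obtain \<pi> where \<pi>: "carrier (ring_of_type Quot I) = range \<pi>"
    "\<And>x y. \<pi> x \<otimes>\<^bsub>ring_of_type Quot I\<^esub> \<pi> y = \<pi> (x * y)"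
    "\<one>\<^bsub>ring_of_type Quot I\<^esub> = \<pi> 1"
    "\<And>x. \<pi> x = \<zero>\<^bsub>ring_of_type Quot I\<^esub> \<longleftrightarrow> x \<in> I"
    using quotient_ring_of_type[OF I] by blast
  show ?thesis
    unfolding completely_prime_ideal_def noncomm_domain_def
    using I ideal.quotient_is_ring[OF I] by (simp add: \<pi>)
qed

theorem theorem1:
  fixes scaleH :: "'k::field_char_0 \<Rightarrow> 'h::{ring, monoid_mult} \<Rightarrow> 'h"
    and \<Delta> :: "'h \<Rightarrow> ('h \<times> 'h \<Rightarrow>\<^sub>0 'k)"
    and \<epsilon> :: "'h \<Rightarrow> 'k"
    and S :: "'h \<Rightarrow> 'h"
    and scaleA :: "'k \<Rightarrow> 'a::{ring, monoid_mult} \<Rightarrow> 'a"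
    and act :: "'h \<Rightarrow> 'a \<Rightarrow> 'a"
    and I :: "'a set"
  assumes "connected_hopf_algebra scaleH \<Delta> \<epsilon> S"
    and "module_algebra scaleH \<Delta> \<epsilon> S scaleA act"
    and "ideal I ring_of_type"
  shows "(prime_ideal I \<longrightarrow> prime_ideal (module_algebra.core act I)) \<and>
    (semiprime_ideal I \<longrightarrow> semiprime_ideal (module_algebra.core act I)) \<and>
    (completely_prime_ideal I \<longrightarrow> completely_prime_ideal (module_algebra.core act I))"
proof -
  interpret connected_module_algebra scaleH \<Delta> \<epsilon> S scaleA act I
    using assms by (intro connected_module_algebra.intro connected_module_algebra_axioms.intro)
  note core = core_largest(1)[OF assms(3)]
  have one: "1 \<notin> I \<Longrightarrow> 1 \<notin> core I"
    using core_largest(2)[OF assms(3)] by blast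
  show ?thesis
    unfolding prime_ideal_iff[OF assms(3)] semiprime_ideal_iff[OF assms(3)]
      completely_prime_ideal_iff[OF assms(3)] prime_ideal_iff[OF core] semiprime_ideal_iff[OF core]
      completely_prime_ideal_iff[OF core]
  proof (intro conjI impI allI)
    assume P: "1 \<notin> I \<and> (\<forall>a b. (\<forall>c. a * c * b \<in> I) \<longrightarrow> a \<in> I \<or> b \<in> I)"
    then show "1 \<notin> core I"
      using one by blast
    fix a b assume *: "\<forall>c. a * c * b \<in> core I"
    show "a \<in> core I \<or> b \<in> core I"
    proof (rule ccontr)
      assume "\<not> (a \<in> core I \<or> b \<in> core I)"
      then obtain h k where "act h a \<notin> I" "act k b \<notin> I"
        "\<And>c. act h a * c * act k b \<notin> I \<Longrightarrow> a * c * b \<notin> core I"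
        using core_mult_reflect[of a b] by metis
      then show False
        using P * by blast
    qed
  next
    fix a
    assume P: "\<forall>a. (\<forall>c. a * c * a \<in> I) \<longrightarrow> a \<in> I" and *: "\<forall>c. a * c * a \<in> core I"
    show "a \<in> core I"
    proof (rule ccontr)
      assume "a \<notin> core I"
      \<comment> \<open>For equal factors both acting elements coincide, which leaves a product of
        the form x c x as semiprimeness requires.\<close>
      then obtain h where "act h a \<notin> I"
        "\<And>c. act h a * c * act h a \<notin> I \<Longrightarrow> a * c * a \<notin> core I"
        using core_mult_reflect[of a a] by metis
      then show False
        using P * by blast
    qed
  next
    assume P: "1 \<notin> I \<and> (\<forall>a b. a * b \<in> I \<longrightarrow> a \<in> I \<or> b \<in> I)"
    then show "1 \<notin> core I"
      using one by blast
    fix a b assume *: "a * b \<in> core I"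
    show "a \<in> core I \<or> b \<in> core I"
    proof (rule ccontr)
      assume "\<not> (a \<in> core I \<or> b \<in> core I)"
      \<comment> \<open>The middle factor c = 1 is enough here, since complete primeness concerns
        plain products.\<close>
      then obtain h k where "act h a \<notin> I" "act k b \<notin> I"
        "act h a * 1 * act k b \<notin> I \<Longrightarrow> a * 1 * b \<notin> core I"
        using core_mult_reflect[of a b] by metis
      then show False
        using P * by auto
    qed
  qed
qed

end
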